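(* For any $\lambda\in(0,2)$, there exist a unique $\beta=\beta(\lambda)>1$ and a homeomorphism $\phi_\lambda:[0,\infty)\to[0,1)$ conjugating $\bigl([0,\infty),T_\lambda\bigr)$ and $\bigl([0,1),S_\beta\bigr)$, i.e. such that $\phi_\lambda\circ T_\lambda=S_\beta\circ\phi_\lambda$.
   Context: For $\beta>1$, $S_\beta:[0,1)\to[0,1)$ is the map $S_\beta(t)=\beta t \bmod 1$. Fix a real number $0<\lambda<2$. Let $h(y)=\frac{1}{\lambda-y}$ and $h_0(y)=\frac{y}{\lambda y+1}$. Define $m_0^\lambda=0$ and, as long as $m_i^\lambda<\lambda$, $m_{i+1}^\lambda=h(m_i^\lambda)$ (so $m_1^\lambda=1/\lambda$). This sequence is increasing and finite: there is an integer $i_\lambda\ge 1$ with $0=m_0^\lambda<m_1^\lambda<\cdots<m_{i_\lambda-1}^\lambda<\lambda\le m_{i_\lambda}^\lambda<\infty$. For $0\le i<i_\lambda$ set $h_{i+1}=h\circ h_i$. Let $I_i^\lambda=[m_i^\lambda,m_{i+1}^\lambda)$ for $0\le i<i_\lambda$ and $I_{i_\lambda}^\lambda=[m_{i_\lambda}^\lambda,\infty)$; these intervals partition $[0,\infty)$. For $i<i_\lambda$, $h_i$ is an increasing bijection from $[0,\infty)$ onto $I_i^\lambda$; $h_{i_\lambda}$ is an increasing bijection from $[0,\ell_\lambda)$ onto $I_{i_\lambda}^\lambda$, where $\ell_\lambda=h_{i_\lambda-1}^{-1}(\lambda)$ if $m_{i_\lambda}^\lambda>\lambda$ and $\ell_\lambda=\infty$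 if $m_{i_\lambda}^\lambda=\lambda$. The map $T_\lambda:[0,\infty)\to[0,\infty)$ is defined by $T_\lambda(x)=h_i^{-1}(x)$ for $x\in I_i^\lambda$. *)

theory Defs
  imports "HOL-Analysis.Analysis"
begin

definition S_beta :: "real \<Rightarrow> real \<Rightarrow> real" where
  "S_beta \<beta> t = frac (\<beta> * t)"

definition h_map :: "real \<Rightarrow> real \<Rightarrow> real" where
  "h_map lam y = 1 / (lam - y)"

definition h0_map :: "real \<Rightarrow> real \<Rightarrow> real" where
  "h0_map lam y = y / (lam * y + 1)"

text \<open>The recursion is run for all indices; the values beyond the first index with
  \<open>lam \<le> m_seq lam i\<close>, which is \<open>i_last lam\<close>, have no meaning and are never used.\<close>

primrec m_seq :: "real \<Rightarrow> nat \<Rightarrow> real" where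
  "m_seq lam 0 = 0"
| "m_seq lam (Suc i) = h_map lam (m_seq lam i)"

definition i_last :: "real \<Rightarrow> nat" where
  "i_last lam = (LEAST i. lam \<le> m_seq lam i)"

primrec h_branch :: "real \<Rightarrow> nat \<Rightarrow> real \<Rightarrow> real" where
  "h_branch lam 0 = h0_map lam"
| "h_branch lam (Suc i) = h_map lam \<circ> h_branch lam i"

definition I_part :: "real \<Rightarrow> nat \<Rightarrow> real set" where
  "I_part lam i = (if i < i_last lam then {m_seq lam i..<m_seq lam (Suc i)} else {m_seq lam i..})"

text \<open>The finite value of \<open>\<ell>\<close>, meaningful only if \<open>m_seq lam (i_last lam) > lam\<close>.
  The case \<open>\<ell> = \<infinity>\<close> is built into \<open>branch_dom\<close>.\<close>

definition ell :: "real \<Rightarrow> real" where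
  "ell lam = inv_into {0..} (h_branch lam (i_last lam - 1)) lam"

definition branch_dom :: "real \<Rightarrow> nat \<Rightarrow> real set" where
  "branch_dom lam i =
     (if i = i_last lam \<and> m_seq lam (i_last lam) > lam then {0..<ell lam} else {0..})"

definition branch_index :: "real \<Rightarrow> real \<Rightarrow> nat" where
  "branch_index lam x = (THE i. i \<le> i_last lam \<and> x \<in> I_part lam i)"

definition T_map :: "real \<Rightarrow> real \<Rightarrow> real" where
  "T_map lam x = (let i = branch_index lam x in inv_into (branch_dom lam i) (h_branch lam i) x)"

end

theory Submission
  imports Defs
begin

text \<open>
  The map \<open>T\<close> and a beta-transformation have the same combinatorics. Coding \<open>x\<close> by the sequence
  \<open>a(x), a(T x), a(T(T x)), \<dots>\<close> of branch indices turns the order of the half-line into the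
  lexicographic order; every branch except the last is onto, and the last one has an image which
  is an initial segment. A conjugacy \<open>\<phi>\<close> to \<open>S_beta \<beta>\<close> has to satisfy
  \<open>\<beta> \<cdot> \<phi>(x) = a(x) + \<phi>(T x)\<close>, so with \<open>r = 1/\<beta>\<close> it is the series
  \<open>\<Phi>\<^sub>r(x) = \<Sum>k. a(T\<^sup>k x) r\<^sup>k\<^sup>+\<^sup>1\<close>. Hence only \<open>r\<close> is free.

  The right \<open>r\<close> is singled out by \<open>sup \<Phi>\<^sub>r = 1\<close>. The supremum is continuous and strictly
  increasing in \<open>r\<close>, is below \<open>1\<close> for small \<open>r\<close> and exceeds \<open>1\<close> near \<open>r = 1\<close>, so there is exactly
  one such value (\<open>ex_critical\<close>, \<open>critical_unique\<close>). A conjugacy has range \<open>[0,1)\<close> and matches the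
  zeros of \<open>T\<close> with the zeros of \<open>S_beta \<beta>\<close>, hence the digits, so its \<open>r\<close> is the critical one
  (\<open>conjugacy_imp_critical\<close>). This is uniqueness of \<open>\<beta>\<close>. Conversely, at the critical \<open>r\<close> the bound
  \<open>\<Phi>\<^sub>r \<le> 1\<close> says exactly that a larger first digit cannot be outweighed by later digits. So
  \<open>\<Phi>\<^sub>r\<close> is monotone (\<open>phi_mono\<close>), then strictly monotone because digit sequences separate points
  (\<open>phi_less_1\<close>, \<open>phi_strict_mono\<close>), and onto \<open>[0,1)\<close> because greedy expansions can be followed
  backwards along the branches (\<open>phi_onto\<close>).

  Separation of points (\<open>T_map_separating\<close>) is where the specific map enters. In the coordinate
  \<open>w = 1/x\<close> the branch of index \<open>0\<close> is the translation \<open>w \<mapsto> w - \<lambda>\<close>, an isometry. The inverse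
  of \<open>h\<close> becomes \<open>h\<close> itself, so the branch of index \<open>i\<close> is \<open>i\<close> steps of \<open>h\<close> and then the translation. Since \<open>\<lambda> < 2\<close>, the
  Moebius map \<open>h\<close> is elliptic, and it preserves \<open>(u - v)\<^sup>2 / (P(u) P(v))\<close> with the positive
  quadratic \<open>P(u) = u\<^sup>2 - \<lambda> u + 1\<close> that vanishes at its fixed points. A branch of positive index
  starts from \<open>0 < w \<le> \<lambda>\<close>, where \<open>P(w) \<le> 1\<close>, and just before the translation ends in
  \<open>w > \<lambda>\<close>, where \<open>P(w) > 1\<close>. So \<open>T\<close> never contracts distances of \<open>w\<close>, and it expands by a definite
  factor infinitely often, at times when the distance is at most \<open>\<lambda>\<close>. Two different points
  therefore cannot keep the same digits forever.
\<close>

section \<open>Interval maps coded like beta-transformations\<close>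

lemma abs_le_geometric_imp_zero:
  fixes d r C :: real
  assumes r: "0 \<le> r" "r < 1" and le: "\<And>n. \<bar>d\<bar> \<le> r ^ n * C"
  shows "d = 0"
proof -
  have "(\<lambda>n. r ^ n * C) \<longlonglongrightarrow> 0 * C"
    by (intro tendsto_mult tendsto_const LIMSEQ_power_zero) (use r in auto)
  then have "\<bar>d\<bar> \<le> 0"
    by (intro LIMSEQ_le_const[where X = "\<lambda>n. r ^ n * C"]) (use le in auto)
  then show ?thesis by simp
qed

text \<open>A monotone function with an open image is continuous. Extending \<open>f\<close> by the identity to the
  negative axis makes the image the open set \<open>{..<1}\<close>.\<close>

lemma strict_mono_onto_imp_homeomorphism:
  fixes f :: "real \<Rightarrow> real"
  assumes mono: "strict_mono_on {0..} f" and onto: "f ` {0..} = {0..<1}"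
  shows "\<exists>g. homeomorphism {0..} {0..<1} f g"
proof -
  define F where "F x = (if x < 0 then x else f x)" for x
  have range: "f x \<in> {0..<1}" if "0 \<le> x" for x
    using onto that by auto
  have "range F = {..<1}"
  proof
    show "range F \<subseteq> {..<1}"
    proof (rule image_subsetI)
      fix x :: real
      show "F x \<in> {..<1}"
        using range[of x] by (cases "x < 0") (simp_all add: F_def)
    qed
    show "{..<1} \<subseteq> range F"
    proof
      fix t :: real assume "t \<in> {..<1}"
      then consider "t < 0" | "t \<in> f ` {0..}"
        using onto by fastforce
      then show "t \<in> range F"
      proof cases
        case 1
        then show ?thesis by (intro range_eqI[of _ _ t]) (simp add: F_def)
      next
        case 2
        then obtain x where "0 \<le> x" "t = f x" by auto
        then show ?thesis by (intro range_eqI[of _ _ x]) (simp add: F_def)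
      qed
    qed
  qed
  moreover have "F x \<le> F y" if "x \<le> y" for x y
    using that range[of y] strict_mono_on_leD[OF mono, of x y] by (auto simp: F_def)
  ultimately have "continuous_on UNIV F"
    by (intro continuous_onI_mono) auto
  then have "continuous_on {0..} F"
    by (rule continuous_on_subset) simp
  then have "continuous_on {0..} f"
    by (rule continuous_on_eq) (simp add: F_def)
  then show ?thesis
    by (intro homeomorphism_into_1d onto strict_mono_on_imp_inj_on[OF mono])
      (auto intro: convex_imp_path_connected)
qed

text \<open>A homeomorphism between intervals is monotone; here it cannot be decreasing, as then \<open>f 0\<close>
  would be the greatest element of \<open>{0..<1}\<close>.\<close>

lemma homeomorphism_half_line_strict_mono:
  fixes f :: "real \<Rightarrow> real"
  assumes "homeomorphism {0..} {0..<1} f g"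
  shows "strict_mono_on {0..} f" and "f 0 = 0"
proof -
  have img: "f ` {0..} = {0..<1}" and cont: "continuous_on {0..} f"
    using assms by (auto simp: homeomorphism_def)
  have "inj_on f {0..}"
    using assms by (metis homeomorphism_apply1 inj_on_inverseI)
  then have "strict_mono_on {0..} f \<or> strict_antimono_on {0..} f"
    using injective_eq_monotone_map[OF _ cont] by (simp add: is_interval_ci)
  moreover have "\<not> strict_antimono_on {0..} f"
  proof
    assume anti: "strict_antimono_on {0..} f"
    have "f 0 \<in> {0..<1}"
      using img by blast
    then have "(1 + f 0) / 2 \<in> f ` {0..}"
      unfolding img by simp
    then obtain x where "0 \<le> x" "f x = (1 + f 0) / 2" by auto
    then show False
      using monotone_onD[OF anti, of 0 x] \<open>f 0 \<in> {0..<1}\<close> by (cases "x = 0") auto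
  qed
  ultimately show mono: "strict_mono_on {0..} f" by blast
  have "0 \<in> f ` {0..}"
    unfolding img by simp
  then obtain x where "0 \<le> x" "f x = 0" by auto
  moreover have "f 0 \<in> {0..<1}"
    using img by blast
  ultimately show "f 0 = 0"
    using strict_mono_on_leD[OF mono, of 0 x] by auto
qed

text \<open>The combinatorial part of the argument uses only the following properties of a map \<open>T\<close> with
  digit function \<open>a\<close> and largest digit \<open>q\<close>. The assumption \<open>lexicographic\<close> says that digits order
  the branches and that \<open>T\<close> increases on each of them; \<open>initial_image\<close> has content for the last
  branch only, which may fail to be onto.\<close>

locale beta_like_map =
  fixes T :: "real \<Rightarrow> real" and a :: "real \<Rightarrow> nat" and q :: nat
  assumes nonneg: "0 \<le> x \<Longrightarrow> 0 \<le> T x"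
    and digit_le: "0 \<le> x \<Longrightarrow> a x \<le> q"
    and lexicographic: "0 \<le> x \<Longrightarrow> x < y \<Longrightarrow> a x < a y \<or> a x = a y \<and> T x < T y"
    and full_branch: "i < q \<Longrightarrow> 0 \<le> y \<Longrightarrow> \<exists>x\<ge>0. a x = i \<and> T x = y"
    and initial_image: "0 \<le> x \<Longrightarrow> 0 \<le> y \<Longrightarrow> y \<le> T x \<Longrightarrow> \<exists>u\<ge>0. a u = a x \<and> T u = y"
    and q_pos: "0 < q"
    and last_digit_attained: "\<exists>x\<ge>0. a x = q"
    and separating: "0 \<le> x \<Longrightarrow> x < y \<Longrightarrow> \<exists>n. a ((T ^^ n) x) \<noteq> a ((T ^^ n) y)"
begin

lemma zero_fixed: "T 0 = 0" and digit_zero: "a 0 = 0"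
proof -
  obtain x where x: "x \<ge> 0" "a x = 0" "T x = 0"
    using full_branch[OF q_pos, of 0] by auto
  have "x = 0"
    using lexicographic[of 0 x] nonneg[of 0] x by force
  then show "T 0 = 0" "a 0 = 0" using x by auto
qed

lemma digit_mono: "0 \<le> x \<Longrightarrow> x \<le> y \<Longrightarrow> a x \<le> a y"
  using lexicographic[of x y] by (cases "x = y") auto

lemma same_digit_same_image:
  "0 \<le> x \<Longrightarrow> 0 \<le> y \<Longrightarrow> a x = a y \<Longrightarrow> T x = T y \<Longrightarrow> x = y"
  using lexicographic[of x y] lexicographic[of y x] by (cases x y rule: linorder_cases) auto

lemma orbit_nonneg: "0 \<le> x \<Longrightarrow> 0 \<le> (T ^^ n) x"
  by (induction n) (auto intro: nonneg)

lemma orbit_zero: "(T ^^ n) 0 = 0"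
  by (induction n) (auto simp: zero_fixed)

lemma orbit_strict_mono:
  assumes "0 \<le> x" "x < y" "\<And>k. k < n \<Longrightarrow> a ((T ^^ k) x) = a ((T ^^ k) y)"
  shows "(T ^^ n) x < (T ^^ n) y"
  using assms(3)
proof (induction n)
  case (Suc n)
  then have "(T ^^ n) x < (T ^^ n) y" by auto
  then show ?case
    using lexicographic[OF orbit_nonneg[OF assms(1)], of n "(T ^^ n) y"] Suc.prems[of n] by auto
qed (use assms in auto)

lemma first_difference:
  assumes "0 \<le> x" "x < y"
  obtains n where "\<And>k. k < n \<Longrightarrow> a ((T ^^ k) x) = a ((T ^^ k) y)"
    and "a ((T ^^ n) x) < a ((T ^^ n) y)"
proof -
  define n where "n = (LEAST n. a ((T ^^ n) x) \<noteq> a ((T ^^ n) y))"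
  have differ: "a ((T ^^ n) x) \<noteq> a ((T ^^ n) y)"
    unfolding n_def by (rule LeastI_ex) (rule separating[OF assms])
  have agree: "a ((T ^^ k) x) = a ((T ^^ k) y)" if "k < n" for k
    using not_less_Least[of k "\<lambda>n. a ((T ^^ n) x) \<noteq> a ((T ^^ n) y)"] that n_def by auto
  have "a ((T ^^ n) x) < a ((T ^^ n) y)"
    using digit_mono[OF orbit_nonneg[OF assms(1)] less_imp_le[OF orbit_strict_mono[OF assms agree]]]
      differ by fastforce
  with agree show thesis using that by blast
qed

text \<open>The point \<open>0\<close> has the digit sequence \<open>0, 0, \<dots>\<close>, from which every other point is separated.\<close>

lemma ex_nonzero_digit:
  assumes "0 < x"
  obtains n where "0 < a ((T ^^ n) x)"
  using separating[of 0 x] assms by (auto simp: orbit_zero digit_zero)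

section \<open>The digit series\<close>

definition digit_series :: "real \<Rightarrow> real \<Rightarrow> real" where
  "digit_series r x = (\<Sum>k. real (a ((T ^^ k) x)) * r ^ Suc k)"

lemma summable_majorant: "0 \<le> r \<Longrightarrow> r < 1 \<Longrightarrow> summable (\<lambda>k. real q * r ^ Suc k)" for r :: real
  by (intro summable_mult summable_Suc_iff[THEN iffD2] summable_geometric) auto

lemma summable_digit_series:
  assumes "0 \<le> r" "r < 1" "0 \<le> x"
  shows "summable (\<lambda>k. real (a ((T ^^ k) x)) * r ^ Suc k)"
  by (rule summable_comparison_test'[OF summable_majorant[OF assms(1,2)], of 0])
    (use assms in \<open>auto intro!: mult_right_mono digit_le orbit_nonneg\<close>)

lemma digit_series_unfold:
  assumes "0 \<le> r" "r < 1" "0 \<le> x"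
  shows "digit_series r x = r * (a x + digit_series r (T x))"
proof -
  have "digit_series r x =
      real (a x) * r + (\<Sum>k. real (a ((T ^^ Suc k) x)) * r ^ Suc (Suc k))"
    unfolding digit_series_def using suminf_split_head[OF summable_digit_series[OF assms]] by simp
  also have "(\<Sum>k. real (a ((T ^^ Suc k) x)) * r ^ Suc (Suc k)) =
      (\<Sum>k. r * (real (a ((T ^^ k) (T x))) * r ^ Suc k))"
    by (simp only: funpow_Suc_right o_apply power_Suc mult_ac)
  also have "\<dots> = r * digit_series r (T x)"
    unfolding digit_series_def
    by (rule suminf_mult) (rule summable_digit_series, use assms nonneg in auto)
  finally show ?thesis by (simp add: algebra_simps)
qed

lemma digit_series_nonneg: "0 \<le> r \<Longrightarrow> r < 1 \<Longrightarrow> 0 \<le> x \<Longrightarrow> 0 \<le> digit_series r x"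
  unfolding digit_series_def by (intro suminf_nonneg summable_digit_series) auto

lemma suminf_majorant: "0 \<le> r \<Longrightarrow> r < 1 \<Longrightarrow> (\<Sum>k. real q * r ^ Suc k) = q * r / (1 - r)"
  for r :: real
  using suminf_geometric[of r] by (simp add: suminf_mult mult.assoc[symmetric] summable_geometric)

lemma digit_series_le:
  fixes r :: real
  assumes "0 \<le> r" "r < 1" "0 \<le> x"
  shows "digit_series r x \<le> q * r / (1 - r)"
  unfolding digit_series_def suminf_majorant[OF assms(1,2), symmetric]
  by (intro suminf_le summable_digit_series summable_majorant)
    (use assms in \<open>auto intro!: mult_right_mono digit_le orbit_nonneg\<close>)

lemma digit_series_zero: "digit_series r 0 = 0"
  unfolding digit_series_def by (simp add: orbit_zero digit_zero)

lemma digit_series_pos: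
  assumes "0 < r" "r < 1" "0 < x"
  shows "0 < digit_series r x"
proof -
  obtain n where "0 < a ((T ^^ n) x)"
    using ex_nonzero_digit[OF assms(3)] .
  then show ?thesis
    unfolding digit_series_def using assms
    by (intro suminf_pos2[where i = n] summable_digit_series) auto
qed

text \<open>Common initial digits cancel, which reduces comparisons to the first differing digit.\<close>

lemma digit_series_diff:
  assumes "0 \<le> r" "r < 1" "0 \<le> x" "0 \<le> y"
    and "\<And>k. k < n \<Longrightarrow> a ((T ^^ k) x) = a ((T ^^ k) y)"
  shows "digit_series r x - digit_series r y =
    r ^ n * (digit_series r ((T ^^ n) x) - digit_series r ((T ^^ n) y))"
  using assms(5)
proof (induction n)
  case (Suc n)
  then have "digit_series r x - digit_series r y =
      r ^ n * (digit_series r ((T ^^ n) x) - digit_series r ((T ^^ n) y))" by simp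
  also have "\<dots> = r ^ Suc n * (digit_series r ((T ^^ Suc n) x) - digit_series r ((T ^^ Suc n) y))"
    using digit_series_unfold[of r "(T ^^ n) x"] digit_series_unfold[of r "(T ^^ n) y"]
      Suc.prems[of n] orbit_nonneg assms
    by (simp add: algebra_simps)
  finally show ?case .
qed simp

text \<open>The equation is a contraction: it multiplies the distance of two bounded solutions by at
  most \<open>r\<close>.\<close>

lemma digit_series_unique:
  fixes r C :: real and \<phi> :: "real \<Rightarrow> real"
  assumes r: "0 \<le> r" "r < 1"
    and bounded: "\<And>x. 0 \<le> x \<Longrightarrow> \<bar>\<phi> x\<bar> \<le> C"
    and eq: "\<And>x. 0 \<le> x \<Longrightarrow> \<phi> x = r * (a x + \<phi> (T x))"
    and x: "0 \<le> x"
  shows "\<phi> x = digit_series r x"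
proof -
  have "\<bar>\<phi> x - digit_series r x\<bar> \<le> r ^ n * (C + q * r / (1 - r))" if "0 \<le> x" for n x
    using that
  proof (induction n arbitrary: x)
    case 0
    then show ?case
      using bounded[of x] digit_series_le[OF r, of x] digit_series_nonneg[OF r, of x] by auto
  next
    case (Suc n)
    have "\<phi> x - digit_series r x = r * (\<phi> (T x) - digit_series r (T x))"
      using eq[OF Suc.prems] digit_series_unfold[OF r Suc.prems] by (simp add: algebra_simps)
    then have "\<bar>\<phi> x - digit_series r x\<bar> = r * \<bar>\<phi> (T x) - digit_series r (T x)\<bar>"
      using r by (simp add: abs_mult)
    also have "\<dots> \<le> r * (r ^ n * (C + q * r / (1 - r)))"
      by (intro mult_left_mono Suc.IH nonneg Suc.prems r)
    finally show ?case by (simp add: mult.assoc)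
  qed
  from abs_le_geometric_imp_zero[OF r this[OF x]] show ?thesis by simp
qed

section \<open>The critical parameter\<close>

definition sup_series :: "real \<Rightarrow> real" where
  "sup_series r = (SUP x\<in>{0..}. digit_series r x)"

lemma bdd_above_digit_series:
  "0 \<le> r \<Longrightarrow> r < 1 \<Longrightarrow> bdd_above (digit_series r ` {0..})"
  using digit_series_le by (intro bdd_aboveI2) auto

lemma digit_series_le_sup: "0 \<le> r \<Longrightarrow> r < 1 \<Longrightarrow> 0 \<le> x \<Longrightarrow> digit_series r x \<le> sup_series r"
  unfolding sup_series_def by (rule cSUP_upper) (auto simp: bdd_above_digit_series)

lemma sup_series_leI: "(\<And>x. 0 \<le> x \<Longrightarrow> digit_series r x \<le> c) \<Longrightarrow> sup_series r \<le> c"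
  unfolding sup_series_def by (rule cSUP_least) auto

text \<open>Each term \<open>r\<^sup>k\<^sup>+\<^sup>1\<close> gains at least the factor \<open>s / r\<close> when \<open>r\<close> is raised to \<open>s\<close>. This gives
  strict monotonicity of the supremum.\<close>

lemma sup_series_growth:
  assumes "0 < r" "r \<le> s" "s < 1"
  shows "sup_series r \<le> (r / s) * sup_series s"
proof (rule sup_series_leI)
  fix x :: real assume x: "0 \<le> x"
  have term_le: "real (a ((T ^^ k) x)) * r ^ Suc k \<le> (r / s) * (real (a ((T ^^ k) x)) * s ^ Suc k)" for k
  proof -
    have "r ^ k \<le> s ^ k"
      using assms by (intro power_mono) auto
    then have "real (a ((T ^^ k) x)) * r * r ^ k \<le> real (a ((T ^^ k) x)) * r * s ^ k"
      using assms by (intro mult_left_mono) auto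
    then show ?thesis using assms by (simp add: mult_ac)
  qed
  have "digit_series r x \<le> (\<Sum>k. (r / s) * (real (a ((T ^^ k) x)) * s ^ Suc k))"
    unfolding digit_series_def
    by (intro suminf_le summable_mult summable_digit_series term_le) (use assms x in auto)
  also have "\<dots> = (r / s) * digit_series s x"
    unfolding digit_series_def
    by (rule suminf_mult) (rule summable_digit_series, use assms x in auto)
  also have "\<dots> \<le> (r / s) * sup_series s"
    using assms x by (intro mult_left_mono digit_series_le_sup) auto
  finally show "digit_series r x \<le> (r / s) * sup_series s" .
qed

text \<open>The digits are at most \<open>q\<close>, so the increments of all digit series are dominated by that of
  the series with constant digit \<open>q\<close>. The bound does not depend on the point, hence passes to the
  supremum and makes it continuous.\<close>

lemma sup_series_increment:
  fixes r s :: real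
  assumes "0 < r" "r \<le> s" "s < 1"
  shows "sup_series s \<le> sup_series r + (q * s / (1 - s) - q * r / (1 - r))"
proof (rule sup_series_leI)
  fix x :: real assume x: "0 \<le> x"
  have r: "0 \<le> r" "r < 1" and s: "0 \<le> s" "s < 1" using assms by auto
  note sums = summable_digit_series[OF r x] summable_digit_series[OF s x]
    summable_majorant[OF r] summable_majorant[OF s]
  have "real (a ((T ^^ k) x)) * s ^ Suc k - real (a ((T ^^ k) x)) * r ^ Suc k
      \<le> real q * s ^ Suc k - real q * r ^ Suc k" for k
  proof -
    have "r ^ Suc k \<le> s ^ Suc k"
      using assms by (intro power_mono) auto
    then have "real (a ((T ^^ k) x)) * (s ^ Suc k - r ^ Suc k) \<le> real q * (s ^ Suc k - r ^ Suc k)"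
      using digit_le[OF orbit_nonneg[OF x]] by (intro mult_right_mono) auto
    then show ?thesis by (simp add: algebra_simps)
  qed
  then have "(\<Sum>k. real (a ((T ^^ k) x)) * s ^ Suc k - real (a ((T ^^ k) x)) * r ^ Suc k)
      \<le> (\<Sum>k. real q * s ^ Suc k - real q * r ^ Suc k)"
    by (intro suminf_le summable_diff sums)
  then have "digit_series s x - digit_series r x \<le> q * s / (1 - s) - q * r / (1 - r)"
    unfolding digit_series_def suminf_diff[OF sums(2,1), symmetric]
      suminf_majorant[OF r, symmetric] suminf_majorant[OF s, symmetric]
      suminf_diff[OF sums(4,3)] .
  then show "digit_series s x \<le> sup_series r + (q * s / (1 - s) - q * r / (1 - r))"
    using digit_series_le_sup[OF r x] by linarith
qed

lemma sup_series_nonneg: "0 < r \<Longrightarrow> r < 1 \<Longrightarrow> 0 \<le> sup_series r"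
  using digit_series_le_sup[of r 0] by (simp add: digit_series_zero)

lemma continuous_on_sup_series: "continuous_on {0<..<1} sup_series"
  unfolding continuous_on_def
proof
  fix r :: real assume r: "r \<in> {0<..<1}"
  define g where "g s = real q * s / (1 - s)" for s
  have "((\<lambda>s. g s - g r) \<longlongrightarrow> g r - g r) (at r within {0<..<1})"
    unfolding g_def by (intro tendsto_intros) (use r in auto)
  then have lim: "((\<lambda>s. \<bar>g s - g r\<bar>) \<longlongrightarrow> 0) (at r within {0<..<1})"
    using tendsto_rabs_zero by fastforce
  have mono: "sup_series s \<le> sup_series t" if "0 < s" "s \<le> t" "t < 1" for s t
  proof -
    have "sup_series s \<le> (s / t) * sup_series t"
      by (rule sup_series_growth[OF that])
    also have "\<dots> \<le> 1 * sup_series t"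
      using that sup_series_nonneg[of t] by (intro mult_right_mono) auto
    finally show ?thesis by simp
  qed
  have "\<bar>sup_series s - sup_series r\<bar> \<le> \<bar>g s - g r\<bar>" if "s \<in> {0<..<1}" for s
  proof (cases "r \<le> s")
    case True
    then show ?thesis
      using mono[of r s] sup_series_increment[of r s] r that unfolding g_def by auto
  next
    case False
    then show ?thesis
      using mono[of s r] sup_series_increment[of s r] r that unfolding g_def by auto
  qed
  then have "eventually (\<lambda>s. norm (sup_series s - sup_series r) \<le> \<bar>g s - g r\<bar>)
      (at r within {0<..<1})"
    by (auto simp: eventually_at_filter)
  then have "((\<lambda>s. sup_series s - sup_series r) \<longlongrightarrow> 0) (at r within {0<..<1})"
    by (rule Lim_null_comparison[OF _ lim])
  then show "(sup_series \<longlongrightarrow> sup_series r) (at r within {0<..<1})"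
    by (simp add: LIM_zero_iff)
qed

text \<open>The number \<open>1 / r\<close> for critical \<open>r\<close> will be the \<open>\<beta>\<close> of the conjugate beta-transformation.\<close>

definition critical :: "real \<Rightarrow> bool" where
  "critical r \<longleftrightarrow> 0 < r \<and> r < 1 \<and> sup_series r = 1"

lemma critical_unique:
  assumes "critical r" "critical s"
  shows "r = s"
proof -
  have "\<not> r < s" if "critical r" "critical s" for r s
    using that sup_series_growth[of r s] by (auto simp: critical_def field_simps)
  then show ?thesis using assms by (meson linorder_neqE_linordered_idom)
qed

text \<open>This makes the supremum exceed \<open>1\<close> near \<open>r = 1\<close>. A point to the right of another point with
  digit \<open>q\<close> works: its own digit is \<open>q\<close>, and its image is not \<open>0\<close>, so a nonzero digit occurs again.\<close>

lemma ex_point_with_two_nonzero_digits: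
  obtains x n where "0 \<le> x" "0 < a x" "0 < a ((T ^^ Suc n) x)"
proof -
  obtain z where z: "0 \<le> z" "a z = q"
    using last_digit_attained by auto
  define x where "x = z + 1"
  have digit: "a x = q"
    using digit_mono[of z x] digit_le[of x] z unfolding x_def by auto
  then have "0 < T x"
    using lexicographic[of z x] nonneg[of z] z unfolding x_def by auto
  then obtain n where "0 < a ((T ^^ n) (T x))"
    by (rule ex_nonzero_digit)
  then have "0 < a ((T ^^ Suc n) x)"
    by (simp only: funpow_Suc_right o_apply)
  then show thesis
    using that[of x n] digit q_pos z unfolding x_def by auto
qed

lemma ex_critical: "\<exists>r. critical r"
proof -
  \<comment> \<open>With this value the series with constant digit \<open>q\<close> sums to \<open>1/2\<close>.\<close>
  define r where "r = 1 / (2 * real q + 1)"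
  have r: "0 < r" "r < 1" using q_pos unfolding r_def by auto
  have "1 - r = 2 * real q * r"
    unfolding r_def by (simp add: field_simps)
  then have half: "q * r / (1 - r) = 1 / 2"
    using r q_pos by simp
  have lo: "sup_series r \<le> 1"
    by (rule sup_series_leI) (use digit_series_le[of r, unfolded half] r in fastforce)
  obtain x n where x: "0 \<le> x" "0 < a x" "0 < a ((T ^^ Suc n) x)"
    by (rule ex_point_with_two_nonzero_digits)
  \<comment> \<open>For \<open>s\<close> near \<open>1\<close> each of the two nonzero digits contributes more than \<open>1/2\<close>.\<close>
  have "((\<lambda>s::real. s ^ Suc (Suc n)) \<longlongrightarrow> 1 ^ Suc (Suc n)) (at_left 1)"
    by (intro tendsto_intros)
  then have "eventually (\<lambda>s::real. 1 / 2 < s ^ Suc (Suc n)) (at_left 1)"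
    by (rule order_tendstoD) simp
  moreover have "eventually (\<lambda>s. s \<in> {max r (1/2)<..<1}) (at_left 1)"
    by (rule eventually_at_left_real) (use r in auto)
  ultimately have "eventually (\<lambda>s. 1 / 2 < s ^ Suc (Suc n) \<and> s \<in> {max r (1/2)<..<1}) (at_left 1)"
    by (rule eventually_conj)
  then obtain s :: real where s: "1 / 2 < s ^ Suc (Suc n)" "max r (1/2) < s" "s < 1"
    using eventually_happens[of _ "at_left (1::real)"] trivial_limit_at_left_real by fastforce
  have s': "0 \<le> s" "0 < s" "s < 1" using s r by auto
  have "(\<Sum>k\<in>{0, Suc n}. real (a ((T ^^ k) x)) * s ^ Suc k) \<le> digit_series s x"
    unfolding digit_series_def
    by (rule sum_le_suminf[OF summable_digit_series]) (use s' x in auto)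
  then have "real (a x) * s + real (a ((T ^^ Suc n) x)) * s ^ Suc (Suc n) \<le> digit_series s x"
    by (simp del: funpow.simps(2))
  moreover have "1 * s \<le> real (a x) * s"
    using x s' by (intro mult_right_mono) auto
  moreover have "1 * s ^ Suc (Suc n) \<le> real (a ((T ^^ Suc n) x)) * s ^ Suc (Suc n)"
    using x s' by (intro mult_right_mono) (auto simp del: funpow.simps(2))
  ultimately have "1 \<le> digit_series s x"
    using s by linarith
  then have hi: "1 \<le> sup_series s"
    using digit_series_le_sup[OF s'(1,3) x(1)] by linarith
  have "\<exists>t\<ge>r. t \<le> s \<and> sup_series t = 1"
    by (rule IVT'[of sup_series, OF lo hi])
      (use s r in \<open>auto intro: continuous_on_subset[OF continuous_on_sup_series]\<close>)
  then obtain t where "r \<le> t" "t \<le> s" "sup_series t = 1" by blast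
  then have "critical t"
    using r s' by (simp add: critical_def)
  then show ?thesis ..
qed

section \<open>The digit series at the critical parameter is a conjugacy\<close>

context
  fixes r assumes crit: "critical r"
begin

abbreviation (input) \<Phi> where "\<Phi> \<equiv> digit_series r"

lemma r_bounds: "0 \<le> r" "0 < r" "r < 1"
  using crit by (auto simp: critical_def)

lemma phi_le_1: "0 \<le> x \<Longrightarrow> \<Phi> x \<le> 1"
  using digit_series_le_sup[of r x] crit by (auto simp: critical_def)

lemmas phi_unfold = digit_series_unfold[OF r_bounds(1,3)]
lemmas phi_nonneg = digit_series_nonneg[OF r_bounds(1,3)]

text \<open>The bound \<open>\<Phi> \<le> 1\<close> limits the contribution of all later digits to that of one unit of the
  first digit. Equality is possible only if \<open>T x\<close> has the largest and \<open>T y\<close> the smallest value.\<close>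

lemma phi_digit_jump:
  assumes "0 \<le> x" "0 \<le> y" "a x < a y"
  shows "\<Phi> x \<le> \<Phi> y"
    and "\<Phi> x = \<Phi> y \<Longrightarrow> \<Phi> (T x) = 1 \<and> T y = 0 \<and> a y = Suc (a x)"
    and "\<Phi> (T x) < 1 \<Longrightarrow> \<Phi> x < \<Phi> y"
proof -
  have step: "real (a x) + 1 \<le> real (a y)"
    using assms(3) by linarith
  have bounds: "\<Phi> (T x) \<le> 1" "0 \<le> \<Phi> (T y)"
    using assms by (auto intro: phi_le_1 phi_nonneg nonneg)
  have eq: "\<Phi> y - \<Phi> x = r * ((a y - (a x + 1)) + (1 - \<Phi> (T x)) + \<Phi> (T y))"
    using phi_unfold[of x] phi_unfold[of y] assms by (simp add: algebra_simps)
  have "0 \<le> r * ((a y - (a x + 1)) + (1 - \<Phi> (T x)) + \<Phi> (T y))"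
    using step bounds r_bounds by (intro mult_nonneg_nonneg) auto
  then show "\<Phi> x \<le> \<Phi> y" using eq by linarith
  show "\<Phi> x < \<Phi> y" if "\<Phi> (T x) < 1"
  proof -
    have "0 < r * ((a y - (a x + 1)) + (1 - \<Phi> (T x)) + \<Phi> (T y))"
      using step bounds r_bounds that by (intro mult_pos_pos) auto
    then show ?thesis using eq by linarith
  qed
  show "\<Phi> (T x) = 1 \<and> T y = 0 \<and> a y = Suc (a x)" if "\<Phi> x = \<Phi> y"
  proof -
    have "(a y - (a x + 1)) + (1 - \<Phi> (T x)) + \<Phi> (T y) = 0"
      using eq that r_bounds by simp
    then have "real (a y) = a x + 1" "\<Phi> (T x) = 1" "\<Phi> (T y) = 0"
      using step bounds by linarith+
    moreover from this(3) have "T y = 0"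
      using digit_series_pos[OF r_bounds(2,3), of "T y"] nonneg[of y] assms by fastforce
    ultimately show ?thesis by linarith
  qed
qed

lemma phi_mono:
  assumes "0 \<le> x" "x \<le> y"
  shows "\<Phi> x \<le> \<Phi> y"
proof (cases "x = y")
  case False
  then have "x < y" using assms by auto
  from first_difference[OF assms(1) this] obtain n where
    agree: "\<And>k. k < n \<Longrightarrow> a ((T ^^ k) x) = a ((T ^^ k) y)" and
    differ: "a ((T ^^ n) x) < a ((T ^^ n) y)" by blast
  have "\<Phi> ((T ^^ n) x) \<le> \<Phi> ((T ^^ n) y)"
    by (rule phi_digit_jump(1)) (use assms differ orbit_nonneg in auto)
  then have "r ^ n * (\<Phi> ((T ^^ n) x) - \<Phi> ((T ^^ n) y)) \<le> 0"
    using r_bounds by (intro mult_nonneg_nonpos) auto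
  then show ?thesis
    using digit_series_diff[OF r_bounds(1,3), of x y n] agree assms by auto
qed simp

text \<open>If the supremum \<open>1\<close> were attained at \<open>x\<close>, then \<open>\<Phi> = 1\<close> on \<open>{x..}\<close>. Among all points \<open>v > x\<close>
  take one whose digits differ from those of \<open>x\<close> as early as possible, at time \<open>n\<close>. Then all points
  beyond \<open>v\<close> also differ from \<open>x\<close> at time \<open>n\<close>, and the equality case of a digit jump forces both
  \<open>T\<^sup>n v\<close> and \<open>T\<^sup>n (v + 1)\<close> to be the left endpoint of the same branch. But these two points are
  distinct, since \<open>v\<close> and \<open>v + 1\<close> have the same earlier digits.\<close>

lemma phi_less_1:
  assumes x: "0 \<le> x"
  shows "\<Phi> x < 1"
proof (rule ccontr)
  assume "\<not> \<Phi> x < 1"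
  then have one: "\<Phi> v = 1" if "x \<le> v" for v
    using phi_mono[OF x that] phi_le_1[of v] x that by linarith
  define differs where "differs v n \<longleftrightarrow> a ((T ^^ n) x) \<noteq> a ((T ^^ n) v)" for v n
  define n where "n = (LEAST n. \<exists>v>x. differs v n)"
  have "\<exists>n. \<exists>v>x. differs v n"
    using separating[OF x, of "x + 1"] by (auto simp: differs_def intro!: exI[of _ "x + 1"])
  then have "\<exists>v>x. differs v n"
    unfolding n_def by (rule LeastI_ex)
  then obtain v where v: "x < v" "differs v n" by auto
  have agree: "a ((T ^^ k) x) = a ((T ^^ k) u)" if "x < u" "k < n" for u k
    using not_less_Least[of k "\<lambda>n. \<exists>v>x. differs v n"] that unfolding n_def differs_def by blast
  have nn: "0 \<le> (T ^^ n) x" "0 \<le> (T ^^ n) v" "0 \<le> (T ^^ n) (v + 1)"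
    using x v by (auto intro!: orbit_nonneg)
  have "(T ^^ n) x < (T ^^ n) v"
    by (rule orbit_strict_mono[OF x v(1)]) (rule agree[OF v(1)])
  then have less: "a ((T ^^ n) x) < a ((T ^^ n) v)"
    using digit_mono[OF nn(1), of "(T ^^ n) v"] v by (auto simp: differs_def)
  have next_less: "(T ^^ n) v < (T ^^ n) (v + 1)"
    by (rule orbit_strict_mono) (use x v agree[of v] agree[of "v + 1"] in auto)
  then have less': "a ((T ^^ n) x) < a ((T ^^ n) (v + 1))"
    using less digit_mono[OF nn(2), of "(T ^^ n) (v + 1)"] by linarith
  have jump: "T ((T ^^ n) u) = 0 \<and> a ((T ^^ n) u) = Suc (a ((T ^^ n) x))"
    if u: "x < u" "a ((T ^^ n) x) < a ((T ^^ n) u)" for u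
  proof -
    have "r ^ n * (\<Phi> ((T ^^ n) x) - \<Phi> ((T ^^ n) u)) = 0"
      using digit_series_diff[OF r_bounds(1,3), of x u n] agree[OF u(1)] one[of x] one[of u] x u
      by auto
    then have "\<Phi> ((T ^^ n) x) = \<Phi> ((T ^^ n) u)"
      using r_bounds by simp
    then show ?thesis
      using phi_digit_jump(2)[OF nn(1) _ u(2)] orbit_nonneg[of u n] x u(1) by auto
  qed
  have "(T ^^ n) v = (T ^^ n) (v + 1)"
    by (rule same_digit_same_image[OF nn(2,3)])
      (simp_all only: jump[OF v(1) less] jump[OF less_trans[OF v(1) less_add_one] less'])
  with next_less show False by simp
qed

lemma phi_strict_mono:
  assumes "0 \<le> x" "x < y"
  shows "\<Phi> x < \<Phi> y"
proof -
  from first_difference[OF assms] obtain n where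
    agree: "\<And>k. k < n \<Longrightarrow> a ((T ^^ k) x) = a ((T ^^ k) y)" and
    differ: "a ((T ^^ n) x) < a ((T ^^ n) y)" by blast
  have "\<Phi> ((T ^^ n) x) < \<Phi> ((T ^^ n) y)"
    by (rule phi_digit_jump(3)) (use assms differ orbit_nonneg nonneg phi_less_1 in auto)
  then have "r ^ n * (\<Phi> ((T ^^ n) x) - \<Phi> ((T ^^ n) y)) < 0"
    using r_bounds by (intro mult_pos_neg) auto
  then show ?thesis
    using digit_series_diff[OF r_bounds(1,3), of x y n] agree assms by auto
qed

lemma phi_approaches_1:
  assumes "t < 1"
  obtains x where "0 \<le> x" "t < \<Phi> x"
proof -
  have "t < (SUP x\<in>{0..}. \<Phi> x)"
    using assms crit by (simp add: critical_def sup_series_def)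
  then show thesis
    using that less_cSUP_iff[OF _ bdd_above_digit_series[OF r_bounds(1,3)], of t] by auto
qed

text \<open>The candidate for a preimage of \<open>t\<close>. Whether \<open>\<Phi> x = t\<close> holds is left open, so that a cut
  exists by order completeness, before continuity of \<open>\<Phi>\<close> is known.\<close>

definition cut :: "real \<Rightarrow> real \<Rightarrow> bool" where
  "cut t x \<longleftrightarrow> 0 \<le> x \<and> (\<forall>u\<ge>0. (u < x \<longrightarrow> \<Phi> u \<le> t) \<and> (x < u \<longrightarrow> t < \<Phi> u))"

lemma cut_unique:
  assumes "cut t x" "cut t y"
  shows "x = y"
proof -
  have "\<not> x < y" if "cut t x" "cut t y" for x y
  proof
    assume "x < y"
    then obtain u where u: "x < u" "u < y" using dense by blast
    have "0 \<le> u"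
      using that(1) u(1) by (simp add: cut_def)
    then have "t < \<Phi> u" "\<Phi> u \<le> t"
      using that u by (auto simp only: cut_def)
    then show False by simp
  qed
  then show ?thesis using assms by (meson linorder_neqE_linordered_idom)
qed

lemma ex_cut:
  assumes "0 \<le> t" "t < 1"
  shows "\<exists>x. cut t x"
proof -
  define U where "U = {u. 0 \<le> u \<and> \<Phi> u \<le> t}"
  obtain z where z: "0 \<le> z" "t < \<Phi> z"
    using phi_approaches_1[OF assms(2)] .
  have zero: "0 \<in> U"
    using assms by (simp add: U_def digit_series_zero)
  have bdd: "bdd_above U"
  proof (rule bdd_aboveI)
    fix u assume "u \<in> U"
    then show "u \<le> z"
      using phi_mono[OF z(1), of u] z(2) unfolding U_def by force
  qed
  have "cut t (Sup U)"
    unfolding cut_def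
  proof (intro conjI allI impI)
    show "0 \<le> Sup U"
      by (rule cSup_upper[OF zero bdd])
    show "\<Phi> u \<le> t" if u: "0 \<le> u" "u < Sup U" for u
    proof -
      obtain w where "w \<in> U" "u < w"
        using less_cSupD[OF _ u(2)] zero by auto
      then show ?thesis
        using phi_mono[OF u(1), of w] by (auto simp: U_def)
    qed
    show "t < \<Phi> u" if u: "0 \<le> u" "Sup U < u" for u
      using cSup_upper[OF _ bdd, of u] u by (force simp: U_def)
  qed
  then show ?thesis ..
qed

text \<open>Cuts are carried along: the point with digit \<open>\<lfloor>t / r\<rfloor>\<close> and image the cut of \<open>frac (t / r)\<close> is a
  cut of \<open>t\<close>, by comparison of first digits. It exists on the last branch, too, since some \<open>\<Phi> z\<close>
  exceeds \<open>t\<close> and \<open>T z\<close> then lies beyond the required image. The error \<open>\<Phi> x - t\<close> is scaled by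
  \<open>r < 1\<close> in this step, which lets it vanish by iteration.\<close>

lemma cut_step:
  assumes t: "0 \<le> t" "t < 1" and cut: "cut t x"
  shows "\<exists>v. cut (frac (t / r)) v \<and> \<Phi> x - t = r * (\<Phi> v - frac (t / r))"
proof -
  define i where "i = nat \<lfloor>t / r\<rfloor>"
  define s where "s = frac (t / r)"
  have s: "0 \<le> s" "s < 1"
    by (simp_all add: s_def frac_ge_0 frac_lt_1)
  have "real i = \<lfloor>t / r\<rfloor>"
    using t r_bounds by (simp add: i_def)
  then have "t / r = real i + s"
    unfolding s_def frac_def by simp
  then have t_eq: "t = r * (real i + s)"
    using r_bounds by (simp add: field_simps)
  obtain v where v: "cut s v"
    using ex_cut[OF s] by blast
  then have "0 \<le> v" by (simp add: cut_def)
  obtain z where z: "0 \<le> z" "t < \<Phi> z"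
    using phi_approaches_1[OF t(2)] .
  have "r * (real i + s) < r * (real (a z) + \<Phi> (T z))"
    using z phi_unfold[OF z(1)] t_eq by simp
  then have z': "real i + s < real (a z) + \<Phi> (T z)"
    using r_bounds by simp
  then have "real i < real (a z) + 1"
    using s phi_less_1[OF nonneg[OF z(1)]] by linarith
  then have "i \<le> a z" by linarith
  have "\<exists>y\<ge>0. a y = i \<and> T y = v"
  proof (cases "i < q")
    case True
    then show ?thesis by (rule full_branch[OF _ \<open>0 \<le> v\<close>])
  next
    case False
    then have "a z = i"
      using \<open>i \<le> a z\<close> digit_le[OF z(1)] by linarith
    then have "s < \<Phi> (T z)" using z' by simp
    then have "v \<le> T z"
      using v nonneg[OF z(1)] unfolding cut_def by force
    then show ?thesis
      using initial_image[OF z(1) \<open>0 \<le> v\<close>] \<open>a z = i\<close> by auto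
  qed
  then obtain y where y: "0 \<le> y" "a y = i" "T y = v" by blast
  have "cut t y"
    unfolding cut_def
  proof (intro conjI allI impI)
    show "0 \<le> y" by fact
    show "\<Phi> u \<le> t" if u: "0 \<le> u" "u < y" for u
    proof -
      have "real (a u) + \<Phi> (T u) \<le> real i + s"
      proof (cases "a u < i")
        case True
        then show ?thesis using phi_le_1[OF nonneg[OF u(1)]] s by linarith
      next
        case False
        then have "a u = i" "T u < v"
          using lexicographic[OF u] y by auto
        then show ?thesis
          using v nonneg[OF u(1)] by (auto simp: cut_def)
      qed
      then show ?thesis
        unfolding t_eq phi_unfold[OF u(1)] using r_bounds by (intro mult_left_mono) auto
    qed
    show "t < \<Phi> u" if u: "0 \<le> u" "y < u" for u
    proof -
      have "real i + s < real (a u) + \<Phi> (T u)"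
      proof (cases "i < a u")
        case True
        then show ?thesis using phi_nonneg[OF nonneg[OF u(1)]] s by linarith
      next
        case False
        then have "a u = i" "v < T u"
          using lexicographic[OF y(1) u(2)] y by auto
        then show ?thesis
          using v nonneg[OF u(1)] by (auto simp: cut_def)
      qed
      then show ?thesis
        unfolding t_eq phi_unfold[OF u(1)] using r_bounds by (intro mult_strict_left_mono) auto
    qed
  qed
  then have "x = y" by (rule cut_unique[OF cut])
  then have "\<Phi> x - t = r * (\<Phi> v - s)"
    using phi_unfold[OF y(1)] y t_eq by (simp add: algebra_simps)
  with v show ?thesis unfolding s_def by blast
qed

lemma phi_onto: "\<Phi> ` {0..} = {0..<1}"
proof
  show "\<Phi> ` {0..} \<subseteq> {0..<1}"
    using phi_nonneg phi_less_1 by auto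
  show "{0..<1} \<subseteq> \<Phi> ` {0..}"
  proof
    fix t :: real assume "t \<in> {0..<1}"
    then have t: "0 \<le> t" "t < 1" by auto
    obtain x where x: "cut t x" using ex_cut[OF t] by blast
    have "\<bar>\<Phi> x - t\<bar> \<le> r ^ n * 1" if "0 \<le> t" "t < 1" "cut t x" for n t x
      using that
    proof (induction n arbitrary: t x)
      case 0
      then have "0 \<le> x" by (simp add: cut_def)
      then show ?case
        using phi_nonneg[of x] phi_le_1[of x] 0 by auto
    next
      case (Suc n)
      obtain v where v: "cut (frac (t / r)) v" "\<Phi> x - t = r * (\<Phi> v - frac (t / r))"
        using cut_step[OF Suc.prems] by blast
      then have "\<bar>\<Phi> x - t\<bar> = r * \<bar>\<Phi> v - frac (t / r)\<bar>"
        using r_bounds by (simp add: abs_mult)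
      also have "\<dots> \<le> r * (r ^ n * 1)"
        by (intro mult_left_mono Suc.IH v(1) r_bounds) (auto simp: frac_ge_0 frac_lt_1)
      finally show ?case by simp
    qed
    from abs_le_geometric_imp_zero[OF r_bounds(1,3) this[OF t x]] have "t = \<Phi> x" by simp
    moreover have "0 \<le> x" using x by (simp add: cut_def)
    ultimately show "t \<in> \<Phi> ` {0..}" by auto
  qed
qed

lemma phi_homeomorphism: "\<exists>\<psi>. homeomorphism {0..} {0..<1} \<Phi> \<psi>"
  by (rule strict_mono_onto_imp_homeomorphism[OF _ phi_onto])
    (auto intro!: strict_mono_onI phi_strict_mono)

lemma phi_conjugates:
  assumes "0 \<le> x"
  shows "\<Phi> (T x) = S_beta (1 / r) (\<Phi> x)"
proof -
  have "1 / r * \<Phi> x = \<Phi> (T x) + of_int (int (a x))"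
    using phi_unfold[OF assms] r_bounds by simp
  moreover have "0 \<le> \<Phi> (T x)" "\<Phi> (T x) < 1"
    using assms by (auto intro: phi_nonneg phi_less_1 nonneg)
  ultimately show ?thesis
    unfolding S_beta_def by (subst eq_commute) (simp add: frac_unique_iff)
qed

end

section \<open>Every conjugacy is a digit series at the critical parameter\<close>

text \<open>The zeros of \<open>T\<close> are the left endpoints of the branches, one for each digit. Counting them
  expresses the digit by the order and \<open>T\<close> alone, which makes it an invariant of increasing
  conjugacies.\<close>

lemma card_zeros_of_T:
  assumes "0 \<le> x"
  shows "card {u. 0 < u \<and> u \<le> x \<and> T u = 0} = a x"
proof -
  have "bij_betw a {u. 0 < u \<and> u \<le> x \<and> T u = 0} {1..a x}"
    unfolding bij_betw_def
  proof (intro conjI subset_antisym)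
    show "inj_on a {u. 0 < u \<and> u \<le> x \<and> T u = 0}"
      by (rule inj_onI) (use same_digit_same_image in \<open>simp add: less_imp_le\<close>)
    have "0 < a u" if "0 < u" "T u = 0" for u
      using lexicographic[of 0 u] that by (auto simp: zero_fixed)
    then show "a ` {u. 0 < u \<and> u \<le> x \<and> T u = 0} \<subseteq> {1..a x}"
      by (force intro: digit_mono)
    show "{1..a x} \<subseteq> a ` {u. 0 < u \<and> u \<le> x \<and> T u = 0}"
    proof
      fix j assume j: "j \<in> {1..a x}"
      have "\<exists>u\<ge>0. a u = j \<and> T u = 0"
      proof (cases "j < q")
        case True
        then show ?thesis by (rule full_branch) simp
      next
        case False
        then have "j = a x" using j digit_le[OF assms] by auto
        then show ?thesis using initial_image[OF assms, of 0] nonneg[OF assms] by auto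
      qed
      then obtain u where u: "0 \<le> u" "a u = j" "T u = 0" by auto
      have "u \<le> x"
        using lexicographic[OF assms, of u] nonneg[OF assms] u j by force
      moreover have "u \<noteq> 0" using u j digit_zero by auto
      ultimately show "j \<in> a ` {u. 0 < u \<and> u \<le> x \<and> T u = 0}"
        using u by force
    qed
  qed
  then show ?thesis using bij_betw_same_card by fastforce
qed

end

lemma card_zeros_of_S_beta:
  assumes "0 < \<beta>" "0 \<le> t"
  shows "card {s. 0 < s \<and> s \<le> t \<and> S_beta \<beta> s = 0} = nat \<lfloor>\<beta> * t\<rfloor>"
proof -
  have "{s. 0 < s \<and> s \<le> t \<and> S_beta \<beta> s = 0} = (\<lambda>j::int. j / \<beta>) ` {1..\<lfloor>\<beta> * t\<rfloor>}"
  proof (intro subset_antisym subsetI)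
    fix s assume s: "s \<in> {s. 0 < s \<and> s \<le> t \<and> S_beta \<beta> s = 0}"
    then have "\<beta> * s \<in> \<int>" by (simp add: S_beta_def)
    then obtain j :: int where j: "\<beta> * s = j" by (auto elim: Ints_cases)
    have "0 < \<beta> * s" "\<beta> * s \<le> \<beta> * t" using s assms by auto
    then have "j \<in> {1..\<lfloor>\<beta> * t\<rfloor>}" unfolding j by (auto simp: le_floor_iff)
    moreover have "s = j / \<beta>" using j assms by (simp add: field_simps)
    ultimately show "s \<in> (\<lambda>j::int. j / \<beta>) ` {1..\<lfloor>\<beta> * t\<rfloor>}" by blast
  next
    fix s assume "s \<in> (\<lambda>j::int. j / \<beta>) ` {1..\<lfloor>\<beta> * t\<rfloor>}"
    then obtain j :: int where j: "1 \<le> j" "j \<le> \<lfloor>\<beta> * t\<rfloor>" "s = j / \<beta>" by auto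
    then have "of_int j \<le> \<beta> * t" by (simp add: le_floor_iff)
    then have "0 < s" "s \<le> t"
      using j(1) assms unfolding j(3) by (simp_all add: pos_divide_le_eq mult.commute)
    moreover have "S_beta \<beta> s = 0"
      using assms unfolding j(3) by (simp add: S_beta_def)
    ultimately show "s \<in> {s. 0 < s \<and> s \<le> t \<and> S_beta \<beta> s = 0}" by simp
  qed
  moreover have "inj_on (\<lambda>j::int. j / \<beta>) {1..\<lfloor>\<beta> * t\<rfloor>}"
    using assms by (auto simp: inj_on_def)
  ultimately show ?thesis by (simp add: card_image)
qed

context beta_like_map
begin

text \<open>Counting zeros shows that \<open>\<lfloor>\<beta> \<cdot> \<phi> x\<rfloor>\<close> is the digit of \<open>x\<close>. Hence \<open>\<phi>\<close> solves the functional
  equation of the digit series and equals it, and its range \<open>{0..<1}\<close> has supremum \<open>1\<close>.\<close>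

lemma conjugacy_imp_critical:
  assumes "1 < \<beta>" and homeo: "homeomorphism {0..} {0..<1} \<phi> \<psi>"
    and conj: "\<And>x. 0 \<le> x \<Longrightarrow> \<phi> (T x) = S_beta \<beta> (\<phi> x)"
  shows "critical (1 / \<beta>)"
proof -
  note mono = homeomorphism_half_line_strict_mono(1)[OF homeo]
    and zero = homeomorphism_half_line_strict_mono(2)[OF homeo]
  have img: "\<phi> ` {0..} = {0..<1}" using homeo by (auto simp: homeomorphism_def)
  then have range: "0 \<le> \<phi> x" "\<phi> x < 1" if "0 \<le> x" for x using that by auto
  have less: "\<phi> x < \<phi> y \<longleftrightarrow> x < y" if "0 \<le> x" "0 \<le> y" for x y
    using strict_mono_on_less[OF mono] that by auto
  have le: "\<phi> x \<le> \<phi> y \<longleftrightarrow> x \<le> y" if "0 \<le> x" "0 \<le> y" for x y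
    using less[OF that(2,1)] by (simp add: linorder_not_less[symmetric])
  have eq0: "\<phi> x = 0 \<longleftrightarrow> x = 0" if "0 \<le> x" for x
    using less[of 0 x] that zero by fastforce
  have digit: "nat \<lfloor>\<beta> * \<phi> x\<rfloor> = a x" if x: "0 \<le> x" for x
  proof -
    have "\<phi> ` {u. 0 < u \<and> u \<le> x \<and> T u = 0} = {s. 0 < s \<and> s \<le> \<phi> x \<and> S_beta \<beta> s = 0}"
    proof (intro subset_antisym subsetI)
      fix s assume "s \<in> \<phi> ` {u. 0 < u \<and> u \<le> x \<and> T u = 0}"
      then obtain u where u: "0 < u" "u \<le> x" "T u = 0" "s = \<phi> u" by auto
      then show "s \<in> {s. 0 < s \<and> s \<le> \<phi> x \<and> S_beta \<beta> s = 0}"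
        using less[of 0 u] le[of u x] conj[of u] zero x by simp
    next
      fix s assume s: "s \<in> {s. 0 < s \<and> s \<le> \<phi> x \<and> S_beta \<beta> s = 0}"
      then have "s \<in> \<phi> ` {0..}"
        unfolding img using range[OF x] by auto
      then obtain u where u: "0 \<le> u" "s = \<phi> u" by auto
      have "0 < u" "u \<le> x"
        using less[of 0 u] le[OF u(1) x] s u zero by auto
      moreover have "T u = 0"
        using conj[OF u(1)] s u eq0[OF nonneg[OF u(1)]] by simp
      ultimately show "s \<in> \<phi> ` {u. 0 < u \<and> u \<le> x \<and> T u = 0}"
        using u by blast
    qed
    moreover have "inj_on \<phi> {u. 0 < u \<and> u \<le> x \<and> T u = 0}"
      by (rule inj_on_subset[OF strict_mono_on_imp_inj_on[OF mono]]) auto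
    ultimately have "card {s. 0 < s \<and> s \<le> \<phi> x \<and> S_beta \<beta> s = 0} = a x"
      using card_zeros_of_T[OF x] by (metis (no_types) card_image)
    then show ?thesis
      using card_zeros_of_S_beta[of \<beta> "\<phi> x"] range[OF x] assms(1) by simp
  qed
  have series: "\<phi> x = digit_series (1 / \<beta>) x" if "0 \<le> x" for x
  proof (rule digit_series_unique[where \<phi> = \<phi> and C = 1])
    fix y :: real assume y: "0 \<le> y"
    show "\<bar>\<phi> y\<bar> \<le> 1" using range[OF y] by simp
    have "0 \<le> \<beta> * \<phi> y" using range[OF y] assms(1) by simp
    then have "real (a y) = \<lfloor>\<beta> * \<phi> y\<rfloor>"
      using digit[OF y] by (metis int_nat_eq of_int_of_nat_eq zero_le_floor)
    then have "a y + \<phi> (T y) = \<beta> * \<phi> y"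
      using conj[OF y] by (simp add: S_beta_def frac_def)
    then show "\<phi> y = 1 / \<beta> * (a y + \<phi> (T y))"
      using assms(1) by simp
  qed (use assms(1) that in auto)
  have "sup_series (1 / \<beta>) = Sup (\<phi> ` {0..})"
    unfolding sup_series_def using series by (intro SUP_cong) auto
  also have "\<dots> = 1"
    unfolding img by (rule cSup_atLeastLessThan) simp
  finally show ?thesis
    using assms(1) by (simp add: critical_def)
qed

theorem ex1_beta_conjugacy:
  "\<exists>!\<beta>. \<beta> > 1 \<and> (\<exists>\<phi> \<psi>. homeomorphism {0..} {0..<1} \<phi> \<psi> \<and>
    (\<forall>x\<in>{0..}. \<phi> (T x) = S_beta \<beta> (\<phi> x)))"
proof (rule ex_ex1I)
  obtain r where r: "critical r" using ex_critical by blast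
  then have "1 < 1 / r" by (simp add: critical_def)
  then show "\<exists>\<beta>. \<beta> > 1 \<and> (\<exists>\<phi> \<psi>. homeomorphism {0..} {0..<1} \<phi> \<psi> \<and>
    (\<forall>x\<in>{0..}. \<phi> (T x) = S_beta \<beta> (\<phi> x)))"
    using phi_homeomorphism[OF r] phi_conjugates[OF r] by (metis atLeast_iff)
next
  fix \<beta> \<gamma>
  assume "\<beta> > 1 \<and> (\<exists>\<phi> \<psi>. homeomorphism {0..} {0..<1} \<phi> \<psi> \<and>
      (\<forall>x\<in>{0..}. \<phi> (T x) = S_beta \<beta> (\<phi> x)))"
    and "\<gamma> > 1 \<and> (\<exists>\<phi> \<psi>. homeomorphism {0..} {0..<1} \<phi> \<psi> \<and>
      (\<forall>x\<in>{0..}. \<phi> (T x) = S_beta \<gamma> (\<phi> x)))"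
  then have "critical (1 / \<beta>)" "critical (1 / \<gamma>)"
    using conjugacy_imp_critical by (metis atLeast_iff)+
  then show "\<beta> = \<gamma>" using critical_unique by fastforce
qed

end

section \<open>The branches of the map\<close>

context
  fixes lam :: real
  assumes lam: "0 < lam" "lam < 2"
begin

abbreviation (input) q where "q \<equiv> i_last lam"

text \<open>The characteristic polynomial of the matrix with rows \<open>(0, 1)\<close> and \<open>(-1, \<lambda>)\<close> of \<open>h\<close>. Its
  discriminant \<open>\<lambda>\<^sup>2 - 4\<close> is negative, and its roots are the two complex fixed points of \<open>h\<close>.\<close>

definition h_poly :: "real \<Rightarrow> real" where
  "h_poly x = x\<^sup>2 - lam * x + 1"

lemma h_poly_ge: "1 - lam\<^sup>2 / 4 \<le> h_poly x"
proof -
  have "h_poly x = (x - lam / 2)\<^sup>2 + (1 - lam\<^sup>2 / 4)"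
    by (simp add: h_poly_def power2_eq_square algebra_simps)
  then show ?thesis by simp
qed

lemma discriminant_pos: "0 < 1 - lam\<^sup>2 / 4"
  using power_strict_mono[of lam 2 2] lam by simp

lemma h_poly_pos: "0 < h_poly x"
  using h_poly_ge discriminant_pos by (rule less_le_trans[rotated])

text \<open>Since \<open>h\<close> has no real fixed point, it moves points by at least a fixed amount; this makes the
  sequence of endpoints finite.\<close>

lemma h_map_increment:
  assumes "0 \<le> x" "x < lam"
  shows "x + (1 - lam\<^sup>2 / 4) / lam \<le> h_map lam x"
proof -
  have "(1 - lam\<^sup>2 / 4) / lam \<le> h_poly x / (lam - x)"
    using assms h_poly_ge[of x] discriminant_pos by (intro frac_le) auto
  also have "h_poly x / (lam - x) = h_map lam x - x"
    using assms by (simp add: h_poly_def h_map_def field_simps power2_eq_square)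
  finally show ?thesis by simp
qed

lemma ex_lam_le_m_seq: "\<exists>i. lam \<le> m_seq lam i"
proof (rule ccontr)
  assume "\<not> ?thesis"
  then have less: "m_seq lam i < lam" for i by (auto simp: not_le)
  define c where "c = (1 - lam\<^sup>2 / 4) / lam"
  have "0 < c" using discriminant_pos lam by (simp add: c_def)
  have "real i * c \<le> m_seq lam i" for i
  proof (induction i)
    case (Suc i)
    then have "0 \<le> m_seq lam i"
      using \<open>0 < c\<close> by (meson mult_nonneg_nonneg of_nat_0_le_iff order_trans less_imp_le)
    then have "m_seq lam i + c \<le> m_seq lam (Suc i)"
      using h_map_increment[OF _ less, of i] by (simp add: c_def)
    then show ?case
      using Suc by (simp add: algebra_simps del: m_seq.simps)
  qed simp
  moreover obtain n :: nat where "lam < real n * c"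
    using reals_Archimedean3[OF \<open>0 < c\<close>] by blast
  ultimately show False using less[of n] by (meson less_le_trans not_less_iff_gr_or_eq)
qed

lemma lam_le_m_last: "lam \<le> m_seq lam q"
  unfolding i_last_def by (rule LeastI_ex[OF ex_lam_le_m_seq])

lemma m_seq_less_lam: "i < q \<Longrightarrow> m_seq lam i < lam"
  unfolding i_last_def using not_less_Least by (force simp: not_le)

lemma i_last_pos: "0 < q"
  using lam_le_m_last lam by (cases q) auto

lemma m_seq_nonneg: "i \<le> q \<Longrightarrow> 0 \<le> m_seq lam i"
  using m_seq_less_lam by (cases i) (auto simp: h_map_def Suc_le_eq intro: less_imp_le)

lemma m_seq_less_Suc:
  assumes "i < q"
  shows "m_seq lam i < m_seq lam (Suc i)"
proof -
  have "0 < (1 - lam\<^sup>2 / 4) / lam"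
    using discriminant_pos lam by simp
  then show ?thesis
    using h_map_increment[OF m_seq_nonneg[OF less_imp_le[OF assms]] m_seq_less_lam[OF assms]]
    unfolding m_seq.simps by linarith
qed

lemma m_seq_less: "i < j \<Longrightarrow> j \<le> q \<Longrightarrow> m_seq lam i < m_seq lam j"
proof (induction j)
  case (Suc j)
  then show ?case
    using m_seq_less_Suc[of j] by (cases "i = j") auto
qed simp

lemma m_seq_le: "i \<le> j \<Longrightarrow> j \<le> q \<Longrightarrow> m_seq lam i \<le> m_seq lam j"
  using m_seq_less[of i j] by (cases "i = j") auto

lemma h_map_less_iff: "x < lam \<Longrightarrow> y < lam \<Longrightarrow> h_map lam x < h_map lam y \<longleftrightarrow> x < y"
  by (simp add: h_map_def divide_less_cancel frac_less2 field_simps)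

lemma h_map_image: 
  assumes "x < lam"
  shows "h_map lam ` {x..<lam} = {h_map lam x..}"
    and "y < lam \<Longrightarrow> h_map lam ` {x..<y} = {h_map lam x..<h_map lam y}"
proof -
  have le: "h_map lam u \<le> h_map lam v \<longleftrightarrow> u \<le> v" if "u < lam" "v < lam" for u v
    using h_map_less_iff[OF that(2,1)] by (simp add: linorder_not_less[symmetric])
  have pre: "\<exists>u. u < lam \<and> v = h_map lam u" if "h_map lam x \<le> v" for v
  proof -
    have "0 < h_map lam x" using assms by (simp add: h_map_def)
    then have "0 < v" using that by linarith
    then show ?thesis by (intro exI[of _ "lam - 1 / v"]) (simp add: h_map_def)
  qed
  show "h_map lam ` {x..<lam} = {h_map lam x..}"
  proof (intro subset_antisym subsetI)
    fix v assume "v \<in> {h_map lam x..}"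
    then obtain u where "u < lam" "v = h_map lam u" using pre by auto
    then show "v \<in> h_map lam ` {x..<lam}"
      using le[OF assms, of u] \<open>v \<in> _\<close> by auto
  qed (use le assms in auto)
  show "h_map lam ` {x..<y} = {h_map lam x..<h_map lam y}" if y: "y < lam"
  proof (intro subset_antisym subsetI)
    fix v assume "v \<in> {h_map lam x..<h_map lam y}"
    then obtain u where "u < lam" "v = h_map lam u" using pre by auto
    then show "v \<in> h_map lam ` {x..<y}"
      using le[OF assms, of u] h_map_less_iff[OF _ y, of u] \<open>v \<in> _\<close> by auto
  qed (use le[OF assms] h_map_less_iff[OF _ y] y in auto)
qed

lemma h0_map_less_iff: "0 \<le> x \<Longrightarrow> 0 \<le> y \<Longrightarrow> h0_map lam x < h0_map lam y \<longleftrightarrow> x < y"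
proof -
  assume xy: "0 \<le> x" "0 \<le> y"
  then have pos: "0 < lam * x + 1" "0 < lam * y + 1"
    using lam by (simp_all add: add_nonneg_pos)
  show ?thesis
    using pos by (simp add: h0_map_def frac_less_eq divide_less_eq less_divide_eq algebra_simps)
qed

lemma h0_map_image: "h0_map lam ` {0..} = {0..<1 / lam}"
proof (intro subset_antisym subsetI)
  fix v assume "v \<in> h0_map lam ` {0..}"
  then obtain y where y: "0 \<le> y" "v = y / (lam * y + 1)" by (auto simp: h0_map_def)
  then have "0 < lam * y + 1" using lam by (simp add: add_nonneg_pos)
  then have "0 \<le> v" "v < 1 / lam"
    using y lam by (simp_all add: pos_divide_less_eq) (simp add: field_simps)
  then show "v \<in> {0..<1 / lam}" by simp
next
  fix v assume "v \<in> {0..<1 / lam}"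
  then have v: "0 \<le> v" "0 < 1 - lam * v" using lam by (auto simp: field_simps)
  have "v = h0_map lam (v / (1 - lam * v))"
    using v by (simp add: h0_map_def field_simps)
  then show "v \<in> h0_map lam ` {0..}"
    using v by (intro image_eqI[where x = "v / (1 - lam * v)"]) auto
qed

lemma full_branch_image:
  assumes "i < q"
  shows "strict_mono_on {0..} (h_branch lam i)"
    and "h_branch lam i ` {0..} = {m_seq lam i..<m_seq lam (Suc i)}"
proof -
  have "strict_mono_on {0..} (h_branch lam i) \<and>
    h_branch lam i ` {0..} = {m_seq lam i..<m_seq lam (Suc i)}"
    using assms
  proof (induction i)
    case 0
    show ?case
      using h0_map_less_iff h0_map_image by (auto simp: h_map_def intro!: strict_mono_onI)
  next
    case (Suc i)
    then have IH: "strict_mono_on {0..} (h_branch lam i)"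
      "h_branch lam i ` {0..} = {m_seq lam i..<m_seq lam (Suc i)}" by auto
    have less: "m_seq lam (Suc i) < lam" "m_seq lam i < lam"
      using Suc.prems by (auto simp del: m_seq.simps intro: m_seq_less_lam)
    have "h_branch lam i y < lam" if "0 \<le> y" for y
    proof -
      have "h_branch lam i y \<in> {m_seq lam i..<m_seq lam (Suc i)}"
        unfolding IH(2)[symmetric] using that by auto
      then show ?thesis using less by (auto simp del: m_seq.simps)
    qed
    then have "strict_mono_on {0..} (h_branch lam (Suc i))"
      using strict_mono_onD[OF IH(1)] by (auto intro!: strict_mono_onI simp: h_map_less_iff)
    moreover have "h_branch lam (Suc i) ` {0..} = h_map lam ` {m_seq lam i..<m_seq lam (Suc i)}"
      unfolding h_branch.simps image_comp[symmetric] IH(2) ..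
    ultimately show ?case
      using h_map_image(2)[OF less(2,1)] by (simp only: m_seq.simps)
  qed
  then show "strict_mono_on {0..} (h_branch lam i)"
    "h_branch lam i ` {0..} = {m_seq lam i..<m_seq lam (Suc i)}" by auto
qed

text \<open>The set \<open>branch_dom lam (i_last lam)\<close> is cut off just where the next-to-last branch reaches
  \<open>\<lambda>\<close>, the pole of \<open>h\<close>. In the case of equality \<open>m_seq lam (i_last lam) = lam\<close> nothing is cut off.\<close>

lemma last_domain:
  obtains p where "q = Suc p" "branch_dom lam q \<subseteq> {0..}"
    "h_branch lam p ` branch_dom lam q = {m_seq lam p..<lam}"
proof -
  obtain p where p: "q = Suc p" using i_last_pos by (cases q) auto
  then have "p < q" by simp
  note mono = full_branch_image(1)[OF this] and image = full_branch_image(2)[OF this, folded p]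
  show thesis
  proof (cases "lam < m_seq lam q")
    case False
    then have eq: "m_seq lam q = lam" using lam_le_m_last by simp
    then have "branch_dom lam q = {0..}" by (simp add: branch_dom_def)
    then show thesis using that[OF p] image eq by simp
  next
    case True
    then have dom: "branch_dom lam q = {0..<ell lam}" by (simp add: branch_dom_def)
    have "lam \<in> h_branch lam p ` {0..}"
      unfolding image using True m_seq_less_lam[OF \<open>p < q\<close>] by simp
    then have ell: "0 \<le> ell lam" "h_branch lam p (ell lam) = lam"
      using f_inv_into_f[of lam "h_branch lam p" "{0..}"]
        inv_into_into[of lam "h_branch lam p" "{0..}"]
      by (simp_all add: ell_def p)
    have "h_branch lam p ` {0..<ell lam} = {m_seq lam p..<lam}"
    proof (intro subset_antisym subsetI)
      fix v assume "v \<in> h_branch lam p ` {0..<ell lam}"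
      then obtain y where y: "0 \<le> y" "y < ell lam" "v = h_branch lam p y" by auto
      then have "v \<in> {m_seq lam p..<m_seq lam q}" unfolding image[symmetric] by simp
      then show "v \<in> {m_seq lam p..<lam}"
        using strict_mono_onD[OF mono, of y "ell lam"] y ell by simp
    next
      fix v assume v: "v \<in> {m_seq lam p..<lam}"
      then have "v \<in> h_branch lam p ` {0..}" unfolding image using True by simp
      then obtain y where y: "0 \<le> y" "v = h_branch lam p y" by auto
      then have "y < ell lam"
        using strict_mono_on_leD[OF mono, of "ell lam" y] ell v by force
      then show "v \<in> h_branch lam p ` {0..<ell lam}" using y by simp
    qed
    then show thesis
      by (intro that[OF p]) (auto simp: dom)
  qed
qed

lemma branch_dom_full: "i < q \<Longrightarrow> branch_dom lam i = {0..}"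
  by (simp add: branch_dom_def)

lemma branch_dom_nonneg: "i \<le> q \<Longrightarrow> y \<in> branch_dom lam i \<Longrightarrow> 0 \<le> y"
  by (auto simp: branch_dom_def split: if_splits)

lemma earlier_branch_less_lam:
  assumes "i \<le> q" "y \<in> branch_dom lam i" "j < i"
  shows "h_branch lam j y < lam"
proof (cases "Suc j < q")
  case True
  then have "h_branch lam j y \<in> {m_seq lam j..<m_seq lam (Suc j)}"
    using full_branch_image(2)[of j] branch_dom_nonneg[OF assms(1,2)] by auto
  then show ?thesis
    using m_seq_less_lam[OF True] by (auto simp del: m_seq.simps)
next
  case False
  then have i: "i = q" "q = Suc j" using assms by auto
  obtain p where "q = Suc p" "h_branch lam p ` branch_dom lam q = {m_seq lam p..<lam}"
    by (rule last_domain)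
  then show ?thesis using assms(2) i by force
qed

lemma branch_image:
  assumes "i \<le> q"
  shows "strict_mono_on (branch_dom lam i) (h_branch lam i)"
    and "h_branch lam i ` branch_dom lam i = I_part lam i"
proof -
  obtain p where p: "q = Suc p" "h_branch lam p ` branch_dom lam q = {m_seq lam p..<lam}"
    "branch_dom lam q \<subseteq> {0..}"
    by (rule last_domain)
  have "p < q" using p by simp
  show "strict_mono_on (branch_dom lam i) (h_branch lam i)"
  proof (cases "i < q")
    case True
    then show ?thesis using full_branch_image(1) by (simp add: branch_dom_full)
  next
    case False
    then have i: "i = q" using assms by simp
    have "h_branch lam p u < lam" if "u \<in> branch_dom lam q" for u
      by (rule earlier_branch_less_lam[OF order_refl that \<open>p < q\<close>])
    then show ?thesis
      using strict_mono_onD[OF full_branch_image(1)[OF \<open>p < q\<close>]] p(3)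
      by (auto intro!: strict_mono_onI simp: i p(1) h_map_less_iff)
  qed
  show "h_branch lam i ` branch_dom lam i = I_part lam i"
  proof (cases "i < q")
    case True
    then show ?thesis
      using full_branch_image(2) by (simp add: branch_dom_full I_part_def)
  next
    case False
    then have i: "i = q" using assms by simp
    have "h_branch lam q ` branch_dom lam q = h_map lam ` {m_seq lam p..<lam}"
      unfolding p(2)[symmetric] image_comp p(1) by simp
    also have "\<dots> = {m_seq lam q..}"
      using h_map_image(1)[OF m_seq_less_lam[OF \<open>p < q\<close>]] p(1) by simp
    finally show ?thesis by (simp add: i I_part_def)
  qed
qed

section \<open>The partition and the map\<close>

lemma I_part_ordered:
  assumes "i < j" "j \<le> q" "x \<in> I_part lam i" "y \<in> I_part lam j"
  shows "x < y"
proof -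
  have "x < m_seq lam (Suc i)"
    using assms by (auto simp: I_part_def simp del: m_seq.simps)
  also have "\<dots> \<le> m_seq lam j"
    using assms by (intro m_seq_le) auto
  also have "\<dots> \<le> y"
    using assms by (auto simp: I_part_def split: if_splits simp del: m_seq.simps)
  finally show ?thesis .
qed

lemma I_part_unique:
  assumes "i \<le> q" "j \<le> q" "x \<in> I_part lam i" "x \<in> I_part lam j"
  shows "i = j"
  using I_part_ordered[of i j x x] I_part_ordered[of j i x x] assms
  by (cases i j rule: linorder_cases) auto

lemma I_part_cover:
  assumes "0 \<le> x"
  shows "\<exists>i\<le>q. x \<in> I_part lam i"
proof (cases "m_seq lam q \<le> x")
  case True
  then show ?thesis by (auto simp: I_part_def)
next
  case False
  define j where "j = (LEAST j. x < m_seq lam j)"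
  have j: "x < m_seq lam j"
    unfolding j_def by (rule LeastI[of _ q]) (use False in simp)
  have "j \<le> q"
    unfolding j_def by (rule Least_le) (use False in simp)
  have "j \<noteq> 0" using j assms by (cases j) auto
  then obtain i where i: "j = Suc i" by (cases j) auto
  then have "m_seq lam i \<le> x"
    using not_less_Least[of i "\<lambda>j. x < m_seq lam j"] by (simp add: j_def[symmetric])
  then show ?thesis
    using i j \<open>j \<le> q\<close> by (intro exI[of _ i]) (auto simp: I_part_def simp del: m_seq.simps)
qed

lemma branch_index_eqI: "i \<le> q \<Longrightarrow> x \<in> I_part lam i \<Longrightarrow> branch_index lam x = i"
  unfolding branch_index_def using I_part_unique by (intro the_equality) auto

lemma branch_index:
  assumes "0 \<le> x"
  shows "branch_index lam x \<le> q" and "x \<in> I_part lam (branch_index lam x)"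
  using I_part_cover[OF assms] branch_index_eqI by auto

lemma T_map_inverse:
  assumes "0 \<le> x"
  shows "T_map lam x \<in> branch_dom lam (branch_index lam x)"
    and "h_branch lam (branch_index lam x) (T_map lam x) = x"
  using branch_index[OF assms] branch_image(2)
  by (simp_all add: T_map_def Let_def inv_into_into f_inv_into_f)

lemma branch_of_h_branch:
  assumes "i \<le> q" "y \<in> branch_dom lam i"
  shows "0 \<le> h_branch lam i y" and "branch_index lam (h_branch lam i y) = i"
    and "T_map lam (h_branch lam i y) = y"
proof -
  have part: "h_branch lam i y \<in> I_part lam i"
    using branch_image(2)[OF assms(1)] assms(2) by auto
  then show "0 \<le> h_branch lam i y"
    using m_seq_nonneg[OF assms(1)] by (auto simp: I_part_def split: if_splits)
  show index: "branch_index lam (h_branch lam i y) = i"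
    by (rule branch_index_eqI[OF assms(1) part])
  show "T_map lam (h_branch lam i y) = y"
    using inv_into_f_f[OF strict_mono_on_imp_inj_on[OF branch_image(1)[OF assms(1)]] assms(2)]
    by (simp add: T_map_def index)
qed

lemma T_map_nonneg: "0 \<le> x \<Longrightarrow> 0 \<le> T_map lam x"
  using T_map_inverse(1) branch_index(1) branch_dom_nonneg by blast

lemma T_map_lexicographic:
  assumes "0 \<le> x" "x < y"
  shows "branch_index lam x < branch_index lam y \<or>
    branch_index lam x = branch_index lam y \<and> T_map lam x < T_map lam y"
proof -
  have y: "0 \<le> y" using assms by simp
  show ?thesis
  proof (cases "branch_index lam x" "branch_index lam y" rule: linorder_cases)
    case equal
    have "T_map lam x < T_map lam y"
    proof (rule ccontr)
      assume "\<not> ?thesis"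
      then have "h_branch lam (branch_index lam x) (T_map lam y) \<le>
          h_branch lam (branch_index lam x) (T_map lam x)"
        using T_map_inverse(1)[OF assms(1)] T_map_inverse(1)[OF y] equal
        by (intro strict_mono_on_leD[OF branch_image(1)[OF branch_index(1)[OF assms(1)]]]) auto
      then show False
        using T_map_inverse(2)[OF assms(1)] T_map_inverse(2)[OF y] equal assms by simp
    qed
    with equal show ?thesis by simp
  next
    case greater
    then show ?thesis
      using I_part_ordered[OF greater branch_index(1)[OF assms(1)] branch_index(2)[OF y]
          branch_index(2)[OF assms(1)]] assms by simp
  qed simp
qed

section \<open>Points with equal digits coincide\<close>

text \<open>If \<open>\<zeta>\<close> is the root of \<open>h_poly\<close> in the upper half-plane, this is, up to a constant factor, the
  squared sine of the angle between \<open>x - \<zeta>\<close> and \<open>y - \<zeta>\<close>. In the disc model centred at \<open>\<zeta>\<close> it is a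
  squared chord length; \<open>h\<close> acts there as a rotation and \<open>x \<mapsto> 1/x\<close> as a reflection.\<close>

definition chord :: "real \<Rightarrow> real \<Rightarrow> real" where
  "chord x y = (x - y)\<^sup>2 / (h_poly x * h_poly y)"

lemma chord_h_map:
  assumes "x \<noteq> lam" "y \<noteq> lam"
  shows "chord (h_map lam x) (h_map lam y) = chord x y"
proof -
  have h_poly_h: "h_poly (h_map lam z) = h_poly z / (lam - z)\<^sup>2" if "z \<noteq> lam" for z
  proof -
    have "h_poly (h_map lam z) = (1 - lam * (lam - z) + (lam - z)\<^sup>2) / (lam - z)\<^sup>2"
      using that by (simp add: h_poly_def h_map_def add_divide_distrib diff_divide_distrib power2_eq_square)
    also have "1 - lam * (lam - z) + (lam - z)\<^sup>2 = h_poly z"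
      by (simp add: h_poly_def power2_eq_square algebra_simps)
    finally show ?thesis .
  qed
  have diff: "h_map lam x - h_map lam y = (x - y) / ((lam - x) * (lam - y))"
    using assms by (simp add: h_map_def field_simps)
  show ?thesis
    unfolding chord_def diff h_poly_h[OF assms(1)] h_poly_h[OF assms(2)]
    using assms by (simp add: power_divide power_mult_distrib)
qed

lemma chord_inverse:
  assumes "x \<noteq> 0" "y \<noteq> 0"
  shows "chord (1 / x) (1 / y) = chord x y"
proof -
  have h_poly_inv: "h_poly (1 / z) = h_poly z / z\<^sup>2" if "z \<noteq> 0" for z
    using that by (simp add: h_poly_def field_simps power2_eq_square)
  have diff: "1 / x - 1 / y = (y - x) / (x * y)"
    using assms by (simp add: field_simps)
  show ?thesis
    unfolding chord_def diff h_poly_inv[OF assms(1)] h_poly_inv[OF assms(2)]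
    using assms by (simp add: power_divide power_mult_distrib power2_commute)
qed

lemma chord_h_branch:
  assumes "\<And>j. j < i \<Longrightarrow> h_branch lam j x < lam" "\<And>j. j < i \<Longrightarrow> h_branch lam j y < lam"
  shows "chord (h_branch lam i x) (h_branch lam i y) = chord (h0_map lam x) (h0_map lam y)"
  using assms
proof (induction i)
  case (Suc i)
  have "h_branch lam i x \<noteq> lam" "h_branch lam i y \<noteq> lam"
    using Suc.prems[of i] by auto
  then show ?case
    using Suc by (simp add: chord_h_map)
qed simp

lemma chord_T_map:
  assumes "0 < x" "0 < y" "0 < T_map lam x" "0 < T_map lam y"
    and "branch_index lam x = branch_index lam y"
  shows "chord (1 / x) (1 / y) = chord (lam + 1 / T_map lam x) (lam + 1 / T_map lam y)"
proof -
  define i where "i = branch_index lam x"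
  have dom: "T_map lam x \<in> branch_dom lam i" "T_map lam y \<in> branch_dom lam i"
    and inv: "h_branch lam i (T_map lam x) = x" "h_branch lam i (T_map lam y) = y"
    and i: "i \<le> q"
    using T_map_inverse[of x] T_map_inverse[of y] branch_index(1)[of x] assms
    by (auto simp: i_def)
  have "chord (1 / x) (1 / y) = chord x y"
    using assms by (simp add: chord_inverse)
  also have "\<dots> = chord (h0_map lam (T_map lam x)) (h0_map lam (T_map lam y))"
    using chord_h_branch[of i "T_map lam x" "T_map lam y"]
      earlier_branch_less_lam[OF i] dom by (simp add: inv)
  also have "\<dots> = chord (1 / h0_map lam (T_map lam x)) (1 / h0_map lam (T_map lam y))"
  proof -
    have "h0_map lam z \<noteq> 0" if "0 < z" for z
    proof -
      have "0 < lam * z + 1" using that lam by (simp add: add_pos_pos)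
      then show ?thesis using that by (simp add: h0_map_def)
    qed
    then show ?thesis using assms by (simp add: chord_inverse)
  qed
  also have "1 / h0_map lam z = lam + 1 / z" if "0 < z" for z
    using that by (simp add: h0_map_def field_simps)
  then have "chord (1 / h0_map lam (T_map lam x)) (1 / h0_map lam (T_map lam y)) =
      chord (lam + 1 / T_map lam x) (lam + 1 / T_map lam y)"
    using assms by simp
  finally show ?thesis .
qed

text \<open>In the coordinate \<open>1/x\<close> the branch of index \<open>0\<close> is the translation by \<open>-\<lambda>\<close>.\<close>

lemma T_map_digit_zero:
  assumes "0 < x" "branch_index lam x = 0"
  shows "0 < T_map lam x" and "1 / x = lam + 1 / T_map lam x"
proof -
  have x: "x = T_map lam x / (lam * T_map lam x + 1)" "0 \<le> T_map lam x"
    using T_map_inverse(2)[of x] T_map_nonneg[of x] assms by (auto simp: h0_map_def)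
  then show pos: "0 < T_map lam x"
    using assms(1) by (cases "T_map lam x = 0") auto
  then have "1 / (T_map lam x / (lam * T_map lam x + 1)) = lam + 1 / T_map lam x"
    by (simp add: field_simps)
  then show "1 / x = lam + 1 / T_map lam x"
    using x(1) by simp
qed

lemma positive_digit_ge:
  assumes "0 \<le> x" "0 < branch_index lam x"
  shows "1 / lam \<le> x"
proof -
  have "m_seq lam 1 \<le> m_seq lam (branch_index lam x)"
    using assms branch_index(1)[OF assms(1)] by (intro m_seq_le) auto
  also have "\<dots> \<le> x"
    using branch_index(2)[OF assms(1)] by (auto simp: I_part_def split: if_splits)
  finally show ?thesis by (simp add: h_map_def)
qed

text \<open>The reciprocals of \<open>x\<close> and \<open>y\<close> lie in \<open>{0<..lam}\<close>, where \<open>h_poly\<close> is at most \<open>1\<close>, so \<open>d\<^sup>2\<close> is at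
  most their chord. The points \<open>u\<close> and \<open>v\<close> of the proof have the same chord and lie beyond \<open>\<lambda>\<close>, where
  \<open>h_poly\<close> is at least \<open>1\<close>, and even at least \<open>1 + \<lambda> d'\<close> at the farther one.\<close>

lemma reciprocal_difference_expands:
  assumes "0 < x" "x < y" "branch_index lam x = branch_index lam y"
    and Tx: "0 < T_map lam x" and digit: "0 < branch_index lam x"
  defines "d \<equiv> 1 / x - 1 / y" and "d' \<equiv> 1 / T_map lam x - 1 / T_map lam y"
  shows "d\<^sup>2 * (1 + lam * d) \<le> d'\<^sup>2"
proof -
  define u v where "u = lam + 1 / T_map lam x" and "v = lam + 1 / T_map lam y"
  have Ty: "T_map lam x < T_map lam y"
    using T_map_lexicographic[of x y] assms by auto
  have d_pos: "0 < d" and d'_pos: "0 < d'"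
    using assms(1,2) Tx Ty by (simp_all add: d_def d'_def field_simps)
  have small: "h_poly (1 / z) \<le> 1" if "0 < z" "1 / lam \<le> z" for z
  proof -
    have "1 / z \<le> lam" using that lam by (simp add: field_simps)
    then have "1 / z * (1 / z) \<le> lam * (1 / z)"
      using that by (intro mult_right_mono) auto
    then show ?thesis by (simp add: h_poly_def power2_eq_square)
  qed
  have "h_poly (1 / x) \<le> 1" "h_poly (1 / y) \<le> 1"
    using positive_digit_ge[of x] positive_digit_ge[of y] assms by (auto intro!: small)
  then have prod_le: "h_poly (1 / x) * h_poly (1 / y) \<le> 1"
    using h_poly_pos by (intro mult_le_one) (auto intro: less_imp_le)
  have large: "1 + lam * (w - lam) \<le> h_poly w" if "lam \<le> w" for w
  proof -
    have "lam * (w - lam) \<le> w * (w - lam)"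
      using that by (intro mult_right_mono) auto
    then show ?thesis by (simp add: h_poly_def power2_eq_square algebra_simps)
  qed
  have "u - lam = d' + 1 / T_map lam y" "v - lam = 1 / T_map lam y"
    by (simp_all add: u_def v_def d'_def)
  then have ge: "d' \<le> u - lam" "0 \<le> v - lam" using Tx Ty by auto
  have "1 + lam * d' \<le> 1 + lam * (u - lam)"
    using ge lam by simp
  then have "1 + lam * d' \<le> h_poly u"
    using large[of u] ge d'_pos by linarith
  moreover have "1 \<le> h_poly v"
    using large[of v] ge lam by (smt (verit) mult_nonneg_nonneg)
  ultimately have "(1 + lam * d') * 1 \<le> h_poly u * h_poly v"
    using lam d'_pos by (intro mult_mono) (auto intro: less_imp_le[OF h_poly_pos])
  then have prod_ge: "1 + lam * d' \<le> h_poly u * h_poly v" by simp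
  have pos: "0 < h_poly (1 / x) * h_poly (1 / y)" "0 < h_poly u * h_poly v"
    using h_poly_pos by simp_all
  have "u - v = d'" by (simp add: u_def v_def d'_def)
  then have ratio: "d\<^sup>2 / (h_poly (1 / x) * h_poly (1 / y)) = d'\<^sup>2 / (h_poly u * h_poly v)"
    using chord_T_map[of x y] assms Ty unfolding chord_def u_def v_def by simp
  have "d\<^sup>2 \<le> d\<^sup>2 / (h_poly (1 / x) * h_poly (1 / y))"
    using prod_le pos by (simp add: le_divide_eq mult_left_le)
  then have key: "d\<^sup>2 * (h_poly u * h_poly v) \<le> d'\<^sup>2"
    unfolding ratio using pos by (simp add: le_divide_eq)
  have "d\<^sup>2 * 1 \<le> d\<^sup>2 * (h_poly u * h_poly v)"
    using prod_ge lam d'_pos by (intro mult_left_mono) (auto intro: order_trans[rotated])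
  then have "d\<^sup>2 \<le> d'\<^sup>2" using key by linarith
  then have "d \<le> d'"
    by (rule power2_le_imp_le) (use d'_pos in simp)
  then have "1 + lam * d \<le> h_poly u * h_poly v"
    using prod_ge lam mult_left_mono[of d d' lam] by linarith
  then have "d\<^sup>2 * (1 + lam * d) \<le> d\<^sup>2 * (h_poly u * h_poly v)"
    by (intro mult_left_mono) auto
  then show ?thesis using key by linarith
qed

lemma T_map_orbit_nonneg: "0 \<le> x \<Longrightarrow> 0 \<le> (T_map lam ^^ n) x"
  by (induction n) (auto intro: T_map_nonneg)

text \<open>As long as the digit is \<open>0\<close>, each step subtracts \<open>\<lambda>\<close> from the positive number \<open>1/x\<close>.\<close>

lemma ex_positive_digit:
  assumes "0 < x"
  shows "\<exists>n. 0 < branch_index lam ((T_map lam ^^ n) x)"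
proof (rule ccontr)
  assume "\<not> ?thesis"
  then have zero: "branch_index lam ((T_map lam ^^ n) x) = 0" for n by simp
  have orbit: "0 < (T_map lam ^^ n) x \<and> 1 / x = n * lam + 1 / (T_map lam ^^ n) x" for n
  proof (induction n)
    case (Suc n)
    then show ?case
      using T_map_digit_zero[OF _ zero, of n] by (simp add: algebra_simps)
  qed (use assms in simp)
  obtain n :: nat where "1 / x < n * lam"
    using reals_Archimedean3[OF lam(1)] by blast
  moreover have "0 < 1 / (T_map lam ^^ n) x" using orbit[of n] by simp
  ultimately show False using orbit[of n] by linarith
qed

text \<open>Let \<open>d n\<close> be the difference of the reciprocals of the \<open>n\<close>-th iterates. If all digits agree, it
  never decreases and grows by the factor \<open>1 + \<lambda> \<cdot> d 0\<close> in the square at each of the infinitely many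
  times when the digit is positive. But it is at most \<open>\<lambda>\<close> at these times.\<close>

lemma T_map_separating:
  assumes "0 \<le> x" "x < y"
  shows "\<exists>n. branch_index lam ((T_map lam ^^ n) x) \<noteq> branch_index lam ((T_map lam ^^ n) y)"
proof (rule ccontr)
  assume "\<not> ?thesis"
  then have same: "branch_index lam ((T_map lam ^^ n) x) = branch_index lam ((T_map lam ^^ n) y)"
    for n by simp
  have nonneg: "0 \<le> (T_map lam ^^ n) x" for n
    using assms by (rule_tac T_map_orbit_nonneg)
  have less: "(T_map lam ^^ n) x < (T_map lam ^^ n) y" for n
  proof (induction n)
    case (Suc n)
    then show ?case
      using T_map_lexicographic[OF nonneg[of n], of "(T_map lam ^^ n) y"] same[of n] by auto
  qed (use assms in simp)
  have index_0: "branch_index lam 0 = 0"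
    using m_seq_less_Suc[OF i_last_pos] i_last_pos
    by (intro branch_index_eqI) (auto simp: I_part_def)
  \<comment> \<open>An orbit that reaches \<open>0\<close> has only digits \<open>0\<close> afterwards, but positive points do not.\<close>
  have "0 < (T_map lam ^^ n) x" for n
  proof (rule ccontr)
    assume "\<not> ?thesis"
    then have z: "(T_map lam ^^ n) x = 0" using nonneg[of n] by simp
    have T_0: "T_map lam 0 = 0"
      using branch_of_h_branch(3)[of 0 0] i_last_pos by (simp add: branch_dom_full h0_map_def)
    have "(T_map lam ^^ k) 0 = 0" for k by (induction k) (simp_all add: T_0)
    then have "(T_map lam ^^ (k + n)) x = 0" for k by (simp add: funpow_add z)
    then have "branch_index lam ((T_map lam ^^ (k + n)) y) = 0" for k
      using same[of "k + n"] index_0 by simp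
    then show False
      using ex_positive_digit[of "(T_map lam ^^ n) y"] less[of n] z by (auto simp: funpow_add)
  qed
  note pos = this
  define d where "d n = 1 / (T_map lam ^^ n) x - 1 / (T_map lam ^^ n) y" for n
  have d_pos: "0 < d n" for n
    using pos[of n] less[of n] by (simp add: d_def field_simps)
  have expand: "(d n)\<^sup>2 * (1 + lam * d n) \<le> (d (Suc n))\<^sup>2"
    if "0 < branch_index lam ((T_map lam ^^ n) x)" for n
    using reciprocal_difference_expands[OF pos less same _ that] pos[of "Suc n"]
    by (simp add: d_def)
  have isometric: "d (Suc n) = d n" if "branch_index lam ((T_map lam ^^ n) x) = 0" for n
    using T_map_digit_zero(2)[OF pos that] T_map_digit_zero(2)[of "(T_map lam ^^ n) y"]
      pos[of n] less[of n] same[of n] that by (simp add: d_def)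
  have "d n \<le> d (Suc n)" for n
  proof (cases "branch_index lam ((T_map lam ^^ n) x) = 0")
    case False
    have "(d n)\<^sup>2 * 1 \<le> (d n)\<^sup>2 * (1 + lam * d n)"
      using lam d_pos[of n] by (intro mult_left_mono) auto
    then have "(d n)\<^sup>2 \<le> (d (Suc n))\<^sup>2"
      using expand[of n] False by simp
    then show ?thesis
      by (rule power2_le_imp_le) (use d_pos[of "Suc n"] in simp)
  qed (simp add: isometric)
  then have mono: "d m \<le> d n" if "m \<le> n" for m n
    using that by (rule lift_Suc_mono_le)
  have ex_digit: "\<exists>m\<ge>n. 0 < branch_index lam ((T_map lam ^^ m) x)" for n
  proof -
    obtain k where "0 < branch_index lam ((T_map lam ^^ k) ((T_map lam ^^ n) x))"
      using ex_positive_digit[OF pos] by blast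
    then have "0 < branch_index lam ((T_map lam ^^ (k + n)) x)"
      by (simp add: funpow_add)
    then show ?thesis by (intro exI[of _ "k + n"]) simp
  qed
  define c where "c = 1 + lam * d 0"
  have "1 < c" using lam d_pos by (simp add: c_def)
  have unbounded: "\<exists>n. c ^ k * (d 0)\<^sup>2 \<le> (d n)\<^sup>2" for k
  proof (induction k)
    case (Suc k)
    then obtain n where n: "c ^ k * (d 0)\<^sup>2 \<le> (d n)\<^sup>2" by blast
    obtain m where m: "n \<le> m" "0 < branch_index lam ((T_map lam ^^ m) x)"
      using ex_digit by blast
    have "(d n)\<^sup>2 \<le> (d m)\<^sup>2"
      using mono[OF m(1)] d_pos[of n] by (intro power_mono) auto
    then have "c * (c ^ k * (d 0)\<^sup>2) \<le> c * (d m)\<^sup>2"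
      using n \<open>1 < c\<close> by (intro mult_left_mono) auto
    also have "\<dots> \<le> (1 + lam * d m) * (d m)\<^sup>2"
      unfolding c_def using mono[of 0 m] lam by (intro mult_right_mono) auto
    also have "\<dots> \<le> (d (Suc m))\<^sup>2"
      using expand[OF m(2)] by (simp add: mult.commute)
    finally show ?case by (auto simp: mult.assoc)
  qed (auto intro: exI[of _ 0])
  obtain k where "lam\<^sup>2 / (d 0)\<^sup>2 < c ^ k"
    using real_arch_pow[OF \<open>1 < c\<close>] by blast
  then have "lam\<^sup>2 < c ^ k * (d 0)\<^sup>2"
    using d_pos[of 0] by (simp add: divide_less_eq)
  moreover obtain n where "c ^ k * (d 0)\<^sup>2 \<le> (d n)\<^sup>2"
    using unbounded by blast
  ultimately have "lam\<^sup>2 < (d n)\<^sup>2" by linarith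
  then have "lam < d n"
    by (rule power2_less_imp_less) (use d_pos[of n] in simp)
  moreover obtain m where m: "n \<le> m" "0 < branch_index lam ((T_map lam ^^ m) x)"
    using ex_digit by blast
  moreover have "d m \<le> lam"
  proof -
    have "d m \<le> 1 / (T_map lam ^^ m) x"
      using pos[of m] less[of m] by (simp add: d_def)
    also have "\<dots> \<le> lam"
      using positive_digit_ge[OF nonneg m(2)] pos[of m] lam by (simp add: field_simps)
    finally show ?thesis .
  qed
  ultimately show False using mono[of n m] by linarith
qed

lemma T_map_initial_image:
  assumes "0 \<le> x" "0 \<le> y" "y \<le> T_map lam x"
  shows "\<exists>u\<ge>0. branch_index lam u = branch_index lam x \<and> T_map lam u = y"
proof -
  have "y \<in> branch_dom lam (branch_index lam x)"
    using T_map_inverse(1)[OF assms(1)] assms by (auto simp: branch_dom_def split: if_splits)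
  then show ?thesis
    using branch_of_h_branch[OF branch_index(1)[OF assms(1)]] by blast
qed

lemma T_map_beta_like: "beta_like_map (T_map lam) (branch_index lam) (i_last lam)"
proof
  fix i :: nat and y :: real
  assume "i < i_last lam" "0 \<le> y"
  then show "\<exists>x\<ge>0. branch_index lam x = i \<and> T_map lam x = y"
    using branch_of_h_branch[of i y] by (auto simp: branch_dom_full)
next
  have "0 \<le> m_seq lam (i_last lam)" "m_seq lam (i_last lam) \<in> I_part lam (i_last lam)"
    by (auto simp: I_part_def m_seq_nonneg)
  then show "\<exists>x\<ge>0. branch_index lam x = i_last lam"
    using branch_index_eqI[OF order_refl] by blast
qed (auto intro: T_map_nonneg branch_index(1) T_map_initial_image i_last_pos
    dest: T_map_lexicographic T_map_separating)

end

section \<open>The conjugacy with a beta-transformation\<close>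

theorem theorem4p6:
  fixes lam :: real
  assumes "0 < lam" and "lam < 2"
  shows "\<exists>!\<beta>::real. \<beta> > 1 \<and>
    (\<exists>\<phi> \<psi>. homeomorphism {0..} {0..<1} \<phi> \<psi> \<and>
      (\<forall>x\<in>{0..}. \<phi> (T_map lam x) = S_beta \<beta> (\<phi> x)))"
  by (rule beta_like_map.ex1_beta_conjugacy[OF T_map_beta_like[OF assms]])

end
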